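(* Let $\Delta H$ be a valid Hilbert function with $\Delta H^\star=(h_1^\star,\ldots,h_\alpha^\star)$. Set $$d=\sum_{i=1}^{\alpha-1}\min\left\{\left\lfloor\frac{(h_i^\star-(i-1))_+}{2}\right\rfloor,\ \#\{k \mid i+1\le k\le\alpha \text{ and } h_k^\star\ge i\}\right\}.$$ Then there is a set of fat points $Z$ in $\mathbb{P}^2$ consisting of $d$ double points and $r=\left(\sum\Delta H\right)-3d$ reduced points with $\Delta H_Z=\Delta H$.
   Context: Let $k$ be an algebraically closed field of characteristic zero, $\mathbb{P}^2=\mathbb{P}^2_k$ and $R=k[x_0,x_1,x_2]$ with the standard grading. For distinct points $P_1,\ldots,P_s\in\mathbb{P}^2$ with homogeneous ideals $I_{P_i}$ and positive integers $m_i$, the set of fat points $Z=m_1P_1+\cdots+m_sP_s$ is the scheme defined by $I_Z=I_{P_1}^{m_1}\cap\cdots\cap I_{P_s}^{m_s}$; a point with $m_i=2$ is a double point of $Z$, and one with $m_i=1$ is a reduced point of $Z$. The Hilbert function of $Z$ is $H_Z(i)=\dim_k(R/I_Z)_i$, and its first difference is $\Delta H_Z(i)=H_Z(i)-H_Z(i-1)$ with $H_Z(-1)=0$; writing $\Delta H_Z=(h_0,\ldots,h_\sigma)$ means $\Delta H_Z(i)=h_i$ for $0\le i\le\sigma$ and $\Delta H_Z(i)=0$ for $i>\sigma$. A valid Hilbert function is a finite sequence of positive integers $\Delta H=(h_0,\ldots,h_\sigma)$, $\sigma\ge1$, for which there is an integer $\alpha$ with $1\le\alpha\le\sigma+1$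 such that $h_i=i+1$ for $0\le i<\alpha$ and $\alpha\ge h_\alpha\ge h_{\alpha+1}\ge\cdots\ge h_\sigma$. Its conjugate is $\Delta H^\star=(h_1^\star,\ldots,h_\alpha^\star)$ with $h_i^\star=\#\{j\mid h_j\ge i\}$. Also $\sum\Delta H=\sum_{i=0}^\sigma h_i$, and $n_+=\max\{n,0\}$ for an integer $n$. *)

theory Defs
  imports
    "HOL-Library.Poly_Mapping"
    "HOL-Library.Multiset"
    "HOL-Computational_Algebra.Polynomial"
    "HOL-Analysis.Finite_Cartesian_Product"
begin

section \<open>The graded ring $R = k[x_0,x_1,x_2]$\<close>

text \<open>
  Polynomials are finitely supported functions from exponent vectors to coefficients, so that
  the whole type below is $R$; the three variables are indexed by the three-element type \<open>3\<close>.
\<close>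

type_synonym 'k poly3 = "(3 \<Rightarrow>\<^sub>0 nat) \<Rightarrow>\<^sub>0 'k"

definition scale3 :: "'k::comm_ring_1 \<Rightarrow> 'k poly3 \<Rightarrow> 'k poly3" where
  "scale3 c f = Poly_Mapping.single 0 c * f"

definition mon_deg :: "(3 \<Rightarrow>\<^sub>0 nat) \<Rightarrow> nat" where
  "mon_deg m = (\<Sum>j\<in>UNIV. Poly_Mapping.lookup m j)"

definition homog_part :: "nat \<Rightarrow> 'k::comm_ring_1 poly3 set" where
  "homog_part i = {f. \<forall>m\<in>Poly_Mapping.keys f. mon_deg m = i}"

definition eval3 :: "'k::comm_ring_1 poly3 \<Rightarrow> 'k ^ 3 \<Rightarrow> 'k" where
  "eval3 f v = (\<Sum>m\<in>Poly_Mapping.keys f.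
     Poly_Mapping.lookup f m * (\<Prod>j\<in>UNIV. (v $ j) ^ Poly_Mapping.lookup m j))"

text \<open>
  A commutative ring is a module over itself; \<open>ring_ideal.subspace I\<close> says that \<open>I\<close> is an ideal,
  and \<open>ring_ideal.span S\<close> is the ideal generated by \<open>S\<close>.
\<close>

interpretation ring_ideal: module "(*) :: 'a::comm_ring_1 \<Rightarrow> 'a \<Rightarrow> 'a"
  by unfold_locales (simp_all add: algebra_simps)

definition ideal_power :: "'a::comm_ring_1 set \<Rightarrow> nat \<Rightarrow> 'a set" where
  "ideal_power I m = ring_ideal.span {prod_list fs | fs. length fs = m \<and> set fs \<subseteq> I}"

section \<open>Fat points in the projective plane\<close>

text \<open>A point is the set of all its homogeneous coordinate vectors.\<close>

definition proj_plane :: "('k::field ^ 3) set set" where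
  "proj_plane = {v. v \<noteq> 0} // {(v, w). v \<noteq> 0 \<and> w \<noteq> 0 \<and> (\<exists>c. c \<noteq> 0 \<and> w = c *s v)}"

definition point_ideal :: "('k::field ^ 3) set \<Rightarrow> 'k poly3 set" where
  "point_ideal P = ring_ideal.span {f. (\<exists>i. f \<in> homog_part i) \<and> (\<forall>v\<in>P. eval3 f v = 0)}"

text \<open>
  The multiset \<open>Z\<close> in which the point \<open>P\<close> occurs with multiplicity $m_P$ stands for the fat point
  scheme $\sum_P m_P P$.
\<close>

definition fat_points :: "('k::field ^ 3) set multiset \<Rightarrow> bool" where
  "fat_points Z \<longleftrightarrow> set_mset Z \<subseteq> proj_plane"

definition fat_ideal :: "('k::field ^ 3) set multiset \<Rightarrow> 'k poly3 set" where
  "fat_ideal Z = (\<Inter>P\<in>set_mset Z. ideal_power (point_ideal P) (count Z P))"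

definition double_points :: "('k::field ^ 3) set multiset \<Rightarrow> ('k ^ 3) set set" where
  "double_points Z = {P \<in> set_mset Z. count Z P = 2}"

definition reduced_points :: "('k::field ^ 3) set multiset \<Rightarrow> ('k ^ 3) set set" where
  "reduced_points Z = {P \<in> set_mset Z. count Z P = 1}"

section \<open>Hilbert functions\<close>

text \<open>
  \<open>basis_mod I V B\<close>: the elements of \<open>B\<close> represent, without repetition, a finite \<open>k\<close>-basis of the
  image of \<open>V\<close> in \<open>R/I\<close>. For \<open>V = homog_part i\<close> and homogeneous \<open>I\<close> this image is $(R/I)_i$.
\<close>

definition basis_mod :: "'k::field poly3 set \<Rightarrow> 'k poly3 set \<Rightarrow> 'k poly3 set \<Rightarrow> bool" where
  "basis_mod I V B \<longleftrightarrow> finite B \<and> B \<subseteq> V \<and>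
     (\<forall>c. (\<Sum>b\<in>B. scale3 (c b) b) \<in> I \<longrightarrow> (\<forall>b\<in>B. c b = 0)) \<and>
     (\<forall>f\<in>V. \<exists>c. f - (\<Sum>b\<in>B. scale3 (c b) b) \<in> I)"

definition hilbert_function :: "'k::field poly3 set \<Rightarrow> nat \<Rightarrow> nat" where
  "hilbert_function I i = (THE n. \<exists>B. basis_mod I (homog_part i) B \<and> card B = n)"

definition hilbert_diff :: "'k::field poly3 set \<Rightarrow> nat \<Rightarrow> int" where
  "hilbert_diff I i =
     int (hilbert_function I i) - (if i = 0 then 0 else int (hilbert_function I (i - 1)))"

text \<open>
  The definite description in \<open>hilbert_function\<close> is always proper: its value is
  $\dim_k R_i - \dim_k (R_i \cap I)$.
\<close>

interpretation poly3: vector_space "scale3 :: 'k::field \<Rightarrow> 'k poly3 \<Rightarrow> 'k poly3"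
  by unfold_locales
    (simp_all add: scale3_def distrib_left distrib_right single_add mult_single flip: mult.assoc)

lemma ideal_subspace:
  assumes "ring_ideal.subspace (I :: 'k::field poly3 set)"
  shows "poly3.subspace I"
  using assms by (auto simp: poly3.subspace_def ring_ideal.subspace_def scale3_def)

lemma subspace_homog_part: "poly3.subspace (homog_part i :: 'k::field poly3 set)"
proof (rule poly3.subspaceI)
  fix f g :: "'k poly3"
  assume "f \<in> homog_part i" "g \<in> homog_part i"
  then show "f + g \<in> homog_part i"
    using keys_add[of f g] by (auto simp: homog_part_def)
next
  fix c and f :: "'k poly3"
  assume "f \<in> homog_part i"
  then show "scale3 c f \<in> homog_part i"
    using keys_mult[of "Poly_Mapping.single 0 c" f]
    by (fastforce simp: homog_part_def scale3_def split: if_splits)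
qed (simp add: homog_part_def)

lemma finite_mon_deg: "finite {m. mon_deg m = i}"
proof (rule finite_imageD)
  have "Poly_Mapping.lookup ` {m. mon_deg m = i} \<subseteq> PiE UNIV (\<lambda>_. {..i})"
    by (auto simp: mon_deg_def intro!: member_le_sum)
  then show "finite (Poly_Mapping.lookup ` {m. mon_deg m = i})"
    by (rule finite_subset) (intro finite_PiE, auto)
qed (simp add: inj_on_def poly_mapping_eqI)

lemma homog_part_subset_span:
  "(homog_part i :: 'k::field poly3 set)
     \<subseteq> poly3.span ((\<lambda>m. Poly_Mapping.single m 1) ` {m. mon_deg m = i})" (is "_ \<subseteq> poly3.span ?M")
proof
  fix f :: "'k poly3"
  assume f: "f \<in> homog_part i"
  have "f = (\<Sum>m\<in>Poly_Mapping.keys f. Poly_Mapping.single m (Poly_Mapping.lookup f m))"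
    by (rule poly_mapping_eqI)
      (auto simp: lookup_sum lookup_single when_def in_keys_iff)
  also have "\<dots> = (\<Sum>m\<in>Poly_Mapping.keys f.
      scale3 (Poly_Mapping.lookup f m) (Poly_Mapping.single m 1))"
    by (simp add: scale3_def mult_single)
  also have "\<dots> \<in> poly3.span ?M"
    using f by (intro poly3.span_sum poly3.span_scale poly3.span_base) (auto simp: homog_part_def)
  finally show "f \<in> poly3.span ?M" .
qed

lemma finite_independent_homog_part:
  assumes "poly3.independent B" "B \<subseteq> (homog_part i :: 'k::field poly3 set)"
  shows "finite B"
  using poly3.independent_span_bound[OF finite_imageI[OF finite_mon_deg] assms(1)]
    subset_trans[OF assms(2) homog_part_subset_span] by blast

lemma basis_mod_card:
  assumes I: "poly3.subspace (I :: 'k::field poly3 set)" and B: "basis_mod I (homog_part i) B"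
  shows "card B + poly3.dim (homog_part i \<inter> I) = poly3.dim (homog_part i :: 'k poly3 set)"
proof -
  let ?V = "homog_part i :: 'k poly3 set"
  obtain C where C: "C \<subseteq> ?V \<inter> I" "poly3.independent C" "?V \<inter> I \<subseteq> poly3.span C"
    "card C = poly3.dim (?V \<inter> I)"
    using poly3.basis_exists by blast
  have finC: "finite C"
    using finite_independent_homog_part[OF C(2)] C(1) by blast
  have finB: "finite B" and BV: "B \<subseteq> ?V"
    and ind: "\<And>c. (\<Sum>b\<in>B. scale3 (c b) b) \<in> I \<Longrightarrow> \<forall>b\<in>B. c b = 0"
    and sp: "\<And>f. f \<in> ?V \<Longrightarrow> \<exists>c. f - (\<Sum>b\<in>B. scale3 (c b) b) \<in> I"
    using B by (auto simp: basis_mod_def)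
  have disj: "B \<inter> C = {}"
  proof (rule ccontr)
    assume "B \<inter> C \<noteq> {}"
    then obtain b where b: "b \<in> B" "b \<in> I" using C(1) by blast
    have "(\<Sum>x\<in>B. scale3 (if x = b then 1 else 0) x) = (\<Sum>x\<in>B. if x = b then x else 0)"
      by (rule sum.cong) auto
    then have "(\<Sum>x\<in>B. scale3 (if x = b then 1 else 0) x) = b"
      using finB b by simp
    with ind[of "\<lambda>x. if x = b then 1 else 0"] b show False by auto
  qed
  have "poly3.independent (B \<union> C)"
  proof (rule poly3.independent_if_scalars_zero)
    fix c x
    assume s: "(\<Sum>x\<in>B \<union> C. scale3 (c x) x) = 0" and x: "x \<in> B \<union> C"
    have eq: "(\<Sum>x\<in>B. scale3 (c x) x) + (\<Sum>x\<in>C. scale3 (c x) x) = 0"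
      using s finB finC disj by (simp add: sum.union_disjoint)
    have "(\<Sum>x\<in>C. scale3 (c x) x) \<in> I"
      using C(1) by (intro poly3.subspace_sum[OF I] poly3.subspace_scale[OF I]) auto
    then have "(\<Sum>x\<in>B. scale3 (c x) x) \<in> I"
      using eq poly3.subspace_neg[OF I] by (simp add: add_eq_0_iff2)
    then have cB: "\<forall>b\<in>B. c b = 0" by (rule ind)
    then have "(\<Sum>x\<in>C. scale3 (c x) x) = 0" using eq by simp
    then have "\<forall>b\<in>C. c b = 0"
      using C(2) finC poly3.dependent_finite by blast
    with cB x show "c x = 0" by blast
  qed (use finB finC in auto)
  moreover have "?V \<subseteq> poly3.span (B \<union> C)"
  proof
    fix f assume f: "f \<in> ?V"
    from sp[OF f] obtain c where c: "f - (\<Sum>b\<in>B. scale3 (c b) b) \<in> I" by blast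
    have "f - (\<Sum>b\<in>B. scale3 (c b) b) \<in> ?V"
      using f BV by (intro poly3.subspace_diff[OF subspace_homog_part]
        poly3.subspace_sum[OF subspace_homog_part] poly3.subspace_scale[OF subspace_homog_part]) auto
    with c C(3) have "f - (\<Sum>b\<in>B. scale3 (c b) b) \<in> poly3.span (B \<union> C)"
      using poly3.span_mono[of C "B \<union> C"] by blast
    moreover have "(\<Sum>b\<in>B. scale3 (c b) b) \<in> poly3.span (B \<union> C)"
      by (intro poly3.span_sum poly3.span_scale poly3.span_base) auto
    ultimately show "f \<in> poly3.span (B \<union> C)"
      using poly3.span_add by fastforce
  qed
  ultimately have "card (B \<union> C) = poly3.dim ?V"
    using BV C(1) by (intro poly3.basis_card_eq_dim) auto
  then show ?thesis
    using C(4) finB finC disj by (simp add: card_Un_disjoint)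
qed

lemma basis_mod_exists:
  assumes I: "poly3.subspace (I :: 'k::field poly3 set)"
  shows "\<exists>B. basis_mod I (homog_part i) B"
proof -
  let ?V = "homog_part i :: 'k poly3 set"
  obtain C where C: "C \<subseteq> ?V \<inter> I" "poly3.independent C" "?V \<inter> I \<subseteq> poly3.span C"
    "card C = poly3.dim (?V \<inter> I)"
    by (rule poly3.basis_exists)
  have "C \<subseteq> ?V" using C(1) by simp
  then obtain D where D: "C \<subseteq> D" "D \<subseteq> ?V" "poly3.independent D" "?V \<subseteq> poly3.span D"
    using C(2) by (rule poly3.maximal_independent_subset_extend)
  have finD: "finite D" by (rule finite_independent_homog_part[OF D(3,2)])
  then have finC: "finite C" using D(1) finite_subset by blast
  have split: "(\<Sum>x\<in>D. scale3 (c x) x) =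
      (\<Sum>x\<in>D - C. scale3 (c x) x) + (\<Sum>x\<in>C. scale3 (c x) x)" for c :: "_ \<Rightarrow> 'k"
    by (rule sum.subset_diff[OF D(1) finD])
  have "basis_mod I ?V (D - C)"
    unfolding basis_mod_def
  proof (intro conjI allI impI ballI)
    fix c b
    assume s: "(\<Sum>b\<in>D - C. scale3 (c b) b) \<in> I" and b: "b \<in> D - C"
    have "(\<Sum>b\<in>D - C. scale3 (c b) b) \<in> ?V"
      using D(2) by (intro poly3.subspace_sum[OF subspace_homog_part]
        poly3.subspace_scale[OF subspace_homog_part]) auto
    with s C(3) have "(\<Sum>b\<in>D - C. scale3 (c b) b) \<in> poly3.span C" by blast
    then obtain u where u: "(\<Sum>b\<in>D - C. scale3 (c b) b) = (\<Sum>x\<in>C. scale3 (u x) x)"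
      using poly3.span_finite[OF finC] by auto
    let ?w = "\<lambda>x. if x \<in> C then - u x else c x"
    have "(\<Sum>x\<in>D. scale3 (?w x) x) = 0"
      unfolding split using u by (simp add: sum_negf)
    then have "?w b = 0"
      by (rule poly3.independentD[OF D(3) finD subset_refl]) (use b in auto)
    with b show "c b = 0" by simp
  next
    fix f assume "f \<in> ?V"
    with D(4) obtain u where u: "f = (\<Sum>x\<in>D. scale3 (u x) x)"
      using poly3.span_finite[OF finD] by auto
    have "(\<Sum>x\<in>C. scale3 (u x) x) \<in> I"
      using C(1) by (intro poly3.subspace_sum[OF I] poly3.subspace_scale[OF I]) auto
    then show "\<exists>c. f - (\<Sum>b\<in>D - C. scale3 (c b) b) \<in> I"
      using u split[of u] by (intro exI[of _ u]) simp
  qed (use finD D(2) in auto)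
  then show ?thesis by blast
qed

lemma hilbert_function_eq_dim:
  assumes "ring_ideal.subspace (I :: 'k::field poly3 set)"
  shows "hilbert_function I i
    = poly3.dim (homog_part i :: 'k poly3 set) - poly3.dim (homog_part i \<inter> I)"
proof -
  have card: "card B = poly3.dim (homog_part i :: 'k poly3 set) - poly3.dim (homog_part i \<inter> I)"
    if "basis_mod I (homog_part i) B" for B
    using basis_mod_card[OF ideal_subspace[OF assms] that] by simp
  obtain B where "basis_mod I (homog_part i) B"
    using basis_mod_exists[OF ideal_subspace[OF assms]] by blast
  then show ?thesis
    unfolding hilbert_function_def by (intro the_equality) (auto simp: card)
qed

lemma ideal_fat_ideal: "ring_ideal.subspace (fat_ideal Z)"
  unfolding fat_ideal_def ideal_power_def
  by (rule ring_ideal.subspace_Inter) (auto simp: ring_ideal.subspace_span)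

section \<open>Valid Hilbert functions\<close>

text \<open>
  The sequence $(h_0,\dots,h_\sigma)$ is the list \<open>h\<close> of length $\sigma+1$; the integer \<open>\<alpha>\<close> is
  determined by \<open>h\<close>.
\<close>

definition valid_hilbert_function :: "nat list \<Rightarrow> nat \<Rightarrow> bool" where
  "valid_hilbert_function h \<alpha> \<longleftrightarrow>
     length h \<ge> 2 \<and> (\<forall>i<length h. h ! i > 0) \<and>
     1 \<le> \<alpha> \<and> \<alpha> \<le> length h \<and>
     (\<forall>i<\<alpha>. h ! i = i + 1) \<and>
     (\<alpha> < length h \<longrightarrow> h ! \<alpha> \<le> \<alpha>) \<and>
     (\<forall>i. \<alpha> \<le> i \<and> i + 1 < length h \<longrightarrow> h ! (i + 1) \<le> h ! i)"

lemma valid_hilbert_function_unique: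
  assumes "valid_hilbert_function h \<alpha>" "valid_hilbert_function h \<beta>"
  shows "\<alpha> = \<beta>"
proof (rule linorder_cases[of \<alpha> \<beta>])
  assume "\<alpha> < \<beta>" with assms show ?thesis by (auto simp: valid_hilbert_function_def)
next
  assume "\<beta> < \<alpha>" with assms show ?thesis by (auto simp: valid_hilbert_function_def)
qed

definition conjugate :: "nat list \<Rightarrow> nat \<Rightarrow> nat" where
  "conjugate h i = card {j. j < length h \<and> h ! j \<ge> i}"

text \<open>Truncated subtraction on \<open>nat\<close> is the positive part $(h_i^\star-(i-1))_+$, as $i \ge 1$.\<close>

definition double_count :: "nat list \<Rightarrow> nat \<Rightarrow> nat" where
  "double_count h \<alpha> = (\<Sum>i = 1..\<alpha> - 1.
     min ((conjugate h i - (i - 1)) div 2) (card {k. i + 1 \<le> k \<and> k \<le> \<alpha> \<and> conjugate h k \<ge> i}))"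

end

theory Submission
  imports Defs "HOL-Analysis.Cartesian_Space"
begin

text \<open>
  Write $r_i = h^\star_{i+1}$ for $0 \le i < \alpha$. The diagram of the Hilbert function has its row \<open>i\<close>
  of length $r_i$ starting in column \<open>i\<close>, and $r_0 > r_1 > \dots$. The scheme is built on lines
  $L_0, \dots, L_{\alpha-1}$ so that cutting with $L_0$, passing to the residual scheme, cutting with
  $L_1$, and so on, produces intersections of degrees exactly $r_0, r_1, \dots$ and ends with the
  empty scheme.

  The degrees determine the Hilbert function because they decrease strictly
  (\<open>hilbert_function_fat_nodes\<close>). Let $d$ be the degree of $Z \cap L$ and $Z'$ the residual of $Z$.
  Restriction to $L$ shows that $R_t/(I_Z)_t$ is at least as large as $R_{t-1}/(I_{Z'})_{t-1}$ together
  with $\min(d, t+1)$ binary forms. If $t + 1 \le d$, division by the equation of $L$ shows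
  that nothing else is needed. If $t \ge d$, strict decrease makes the lower bound equal to the degree
  of $Z$, and a double point imposes three conditions and a reduced point one, so that the bound is
  attained again. The argument produces explicit bases (\<open>full_reduction_basis\<close>).

  It remains to place the points. A double point at $L_i \cap L_k$ with $i < k$ uses two units
  of row \<open>i\<close> and, being a reduced point of the residual scheme, one unit of row \<open>k\<close>. Hence any choice of
  pairs that respects the budgets $r_i$ is possible, the rest of each row being filled with reduced
  points that lie on no other line. Row \<open>i\<close> can afford as many pairs as its summand in the
  definition of \<open>double_count\<close> says, provided that every row takes its partners among the later
  rows that this summand counts (\<open>choose_neighbours\<close>).

  For the lines we take tangents of a smooth conic at integral parameters: no three of them meet, and
  the point common to the tangents with parameters \<open>a\<close> and \<open>b\<close> has the coordinates
  $(1 : a + b : ab)$. A reduced point of row \<open>i\<close> is the meeting point of $L_i$ with a tangent whose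
  parameter is at least $\alpha$. All points of the scheme are therefore indexed by pairs of natural
  numbers, and incidence with the lines becomes membership in the pair.
\<close>

text \<open>
  This rule associates products to the left and loops together with the usual rules for
  associativity and commutativity.
\<close>

declare ring_ideal.scale_scale [simp del]

section \<open>Forms along polynomial curves\<close>

text \<open>
  Evaluation at a point is the case of a constant curve, so that the ring homomorphism laws need
  to be proved only once. Curves with linear coordinates give the restriction to a line.
\<close>

definition pullback :: "(3 \<Rightarrow> 'k::comm_ring_1 poly) \<Rightarrow> 'k poly3 \<Rightarrow> 'k poly" where
  "pullback g f = (\<Sum>m\<in>Poly_Mapping.keys f.
     smult (Poly_Mapping.lookup f m) (\<Prod>j\<in>UNIV. g j ^ Poly_Mapping.lookup m j))"

lemma pullback_superset:
  assumes "finite A" "Poly_Mapping.keys f \<subseteq> A"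
  shows "pullback g f = (\<Sum>m\<in>A. 
     smult (Poly_Mapping.lookup f m) (\<Prod>j\<in>UNIV. g j ^ Poly_Mapping.lookup m j))"
  unfolding pullback_def using assms
  by (intro sum.mono_neutral_left) (auto simp: in_keys_iff)

lemma pullback_zero [simp]: "pullback g 0 = 0"
  by (simp add: pullback_def)

lemma pullback_add: "pullback g (f + f') = pullback g f + pullback g f'"
proof -
  let ?A = "Poly_Mapping.keys f \<union> Poly_Mapping.keys f'"
  have "Poly_Mapping.keys (f + f') \<subseteq> ?A" by (rule keys_add)
  then show ?thesis
    by (simp add: pullback_superset[of ?A] lookup_add smult_add_left sum.distrib)
qed

lemma pullback_single:
  "pullback g (Poly_Mapping.single m c) = smult c (\<Prod>j\<in>UNIV. g j ^ Poly_Mapping.lookup m j)"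
  by (simp add: pullback_def)

lemma pullback_sum: "pullback g (sum f A) = (\<Sum>x\<in>A. pullback g (f x))"
  by (induction A rule: infinite_finite_induct) (simp_all add: pullback_add)

lemma poly3_sum_monomials:
  "f = (\<Sum>m\<in>Poly_Mapping.keys f. Poly_Mapping.single m (Poly_Mapping.lookup f m))"
  by (rule poly_mapping_eqI) (auto simp: lookup_sum lookup_single when_def in_keys_iff)

lemma pullback_mult: "pullback g (f * f') = pullback g f * pullback g f'"
proof -
  let ?s = "\<lambda>f m. Poly_Mapping.single m (Poly_Mapping.lookup f m)"
  have "f * f' = (\<Sum>m\<in>Poly_Mapping.keys f. ?s f m) * (\<Sum>m\<in>Poly_Mapping.keys f'. ?s f' m)"
    by (simp flip: poly3_sum_monomials)
  also have "\<dots> = (\<Sum>m\<in>Poly_Mapping.keys f. \<Sum>n\<in>Poly_Mapping.keys f'. ?s f m * ?s f' n)"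
    by (rule sum_product)
  finally have "pullback g (f * f') =
      (\<Sum>m\<in>Poly_Mapping.keys f. \<Sum>n\<in>Poly_Mapping.keys f'. pullback g (?s f m) * pullback g (?s f' n))"
    by (simp add: pullback_sum mult_single pullback_single lookup_add power_add prod.distrib mult_ac)
  also have "\<dots> = pullback g f * pullback g f'"
    unfolding pullback_single by (simp add: pullback_def sum_product)
  finally show ?thesis .
qed

lemma poly_pullback: "poly (pullback g f) x = eval3 f (\<chi> j. poly (g j) x)"
  by (simp add: pullback_def eval3_def poly_sum poly_prod)

lemma eval3_pullback: "eval3 f v = poly (pullback (\<lambda>j. [:v $ j:]) f) 0"
  by (simp add: poly_pullback)

lemma pullback_scale3: "pullback g (scale3 c f) = smult c (pullback g f)"
  by (simp add: scale3_def pullback_mult pullback_single)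

lemma eval3_zero [simp]: "eval3 0 v = 0"
  and eval3_add: "eval3 (f + f') v = eval3 f v + eval3 f' v"
  and eval3_mult: "eval3 (f * f') v = eval3 f v * eval3 f' v"
  and eval3_scale3: "eval3 (scale3 c f) v = c * eval3 f v"
  by (simp_all add: eval3_pullback pullback_add pullback_mult pullback_scale3)

lemma eval3_homogeneous:
  assumes "f \<in> homog_part t"
  shows "eval3 f (c *s v) = c ^ t * eval3 f v"
proof -
  have "(\<Prod>j\<in>UNIV. ((c *s v) $ j) ^ Poly_Mapping.lookup m j) 
      = c ^ t * (\<Prod>j\<in>UNIV. (v $ j) ^ Poly_Mapping.lookup m j)"
    if "m \<in> Poly_Mapping.keys f" for m
    using assms that
    by (auto simp: homog_part_def mon_deg_def power_mult_distrib prod.distrib power_sum)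
  then show ?thesis
    unfolding eval3_def sum_distrib_left
    by (intro sum.cong refl) (simp only: mult.left_commute)
qed

definition coord :: "3 \<Rightarrow> 'k::comm_ring_1 poly3" where
  "coord j = Poly_Mapping.single (Poly_Mapping.single j 1) 1"

lemma pullback_coord [simp]: "pullback g (coord j) = g j"
proof -
  have "(\<Prod>i\<in>UNIV. g i ^ (Poly_Mapping.lookup (Poly_Mapping.single j 1) i)) = (\<Prod>i\<in>UNIV. if i = j then g i else 1)"
    by (intro prod.cong) (auto simp: lookup_single when_def)
  then show ?thesis by (simp add: coord_def pullback_single)
qed

lemma eval3_coord [simp]: "eval3 (coord j) v = v $ j"
  by (simp add: eval3_pullback)

lemma pullback_one [simp]: "pullback g 1 = 1"
  unfolding single_one[symmetric] pullback_single by simp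

lemma pullback_power: "pullback g (f ^ n) = pullback g f ^ n"
  by (induction n) (simp_all add: pullback_mult)

lemma mon_deg_add: "mon_deg (m + m') = mon_deg m + mon_deg m'"
  by (simp add: mon_deg_def lookup_add sum.distrib)

lemma homog_part_mult:
  assumes "f \<in> homog_part s" "g \<in> homog_part t"
  shows "f * g \<in> homog_part (s + t)"
  using assms keys_mult[of f g] by (fastforce simp: homog_part_def mon_deg_add)

lemma one_homog_part: "1 \<in> homog_part 0"
  by (auto simp: homog_part_def mon_deg_def)

lemma homog_part_power:
  assumes "f \<in> homog_part s"
  shows "f ^ n \<in> homog_part (n * s)"
  by (induction n) (use assms in \<open>auto simp: one_homog_part homog_part_mult\<close>)

lemma mon_deg_single: "mon_deg (Poly_Mapping.single j n) = n"
proof -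
  have "mon_deg (Poly_Mapping.single j n) = (\<Sum>i\<in>UNIV. if i = j then n else 0)"
    unfolding mon_deg_def by (intro sum.cong) (auto simp: lookup_single when_def)
  then show ?thesis by simp
qed

lemma coord_homog_part: "coord j \<in> homog_part 1"
  by (auto simp: homog_part_def coord_def mon_deg_single)

text \<open>
  Every form of positive degree is a sum of products of a variable and a form of one degree less. The division statements below are proved by this induction.
\<close>

lemma homog_part_induct [consumes 1, case_names sum scale one coord]:
  assumes f: "f \<in> homog_part t"
    and sum: "\<And>t f g. f \<in> homog_part t \<Longrightarrow> g \<in> homog_part t \<Longrightarrow> P t f \<Longrightarrow> P t g \<Longrightarrow> P t (f + g)"
    and scale: "\<And>t c f. f \<in> homog_part t \<Longrightarrow> P t f \<Longrightarrow> P t (scale3 c f)"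
    and one: "P 0 1"
    and coord: "\<And>t j f. f \<in> homog_part t \<Longrightarrow> P t f \<Longrightarrow> P (Suc t) (coord j * f)"
  shows "P t (f :: 'k::field poly3)"
proof -
  have mono: "P t (Poly_Mapping.single m 1)" if "mon_deg m = t" for m t
    using that
  proof (induction t arbitrary: m)
    case 0
    then have "m = 0" by (auto simp: mon_deg_def intro!: poly_mapping_eqI)
    then show ?case using one by simp
  next
    case (Suc t)
    then obtain j where j: "Poly_Mapping.lookup m j > 0"
      by (metis gr_zeroI mon_deg_def nat.distinct(1) sum.neutral)
    define n where "n = m - Poly_Mapping.single j 1"
    have m: "m = Poly_Mapping.single j 1 + n"
      using j by (intro poly_mapping_eqI) (auto simp: n_def lookup_add lookup_minus lookup_single when_def)
    then have n: "mon_deg n = t" using Suc.prems by (simp add: mon_deg_add mon_deg_single)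
    have "P (Suc t) (coord j * Poly_Mapping.single n 1)"
      by (rule coord[OF _ Suc.IH[OF n]]) (auto simp: homog_part_def n)
    then show ?case by (simp add: coord_def mult_single m)
  qed
  have "P t f \<and> f \<in> homog_part t"
  proof -
    let ?Q = "{f \<in> homog_part t. P t f}"
    have zero: "P t 0"
    proof -
      have "mon_deg (Poly_Mapping.single 1 t :: 3 \<Rightarrow>\<^sub>0 nat) = t" by (rule mon_deg_single)
      from scale[OF _ mono[OF this], of 0] show ?thesis
        by (simp add: homog_part_def mon_deg_single)
    qed
    have "poly3.subspace ?Q"
      using subspace_homog_part[of t]
      by (intro poly3.subspaceI) (auto simp: zero sum scale poly3.subspace_def)
    moreover have "(\<lambda>m. Poly_Mapping.single m 1) ` {m. mon_deg m = t} \<subseteq> ?Q"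
      by (auto simp: mono homog_part_def)
    ultimately have "poly3.span ((\<lambda>m. Poly_Mapping.single m 1) ` {m. mon_deg m = t}) \<subseteq> ?Q"
      by (intro poly3.span_minimal)
    with f homog_part_subset_span[of t] show ?thesis by auto
  qed
  then show ?thesis by simp
qed

section \<open>Linear algebra modulo a subspace\<close>

text \<open>
  Families are lists rather than sets, so that the bases built below by concatenation and by
  multiplication with a fixed form need not be known to be free of repetitions in advance.
\<close>

definition lincomb :: "'k::field list \<Rightarrow> 'k poly3 list \<Rightarrow> 'k poly3" where
  "lincomb cs bs = sum_list (map2 scale3 cs bs)"

lemma lincomb_Nil [simp]: "lincomb cs [] = 0" "lincomb [] bs = 0"
  by (simp_all add: lincomb_def)

lemma lincomb_Cons [simp]: "lincomb (c # cs) (b # bs) = scale3 c b + lincomb cs bs"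
  by (simp add: lincomb_def)

lemma lincomb_append:
  "length cs = length bs \<Longrightarrow> lincomb (cs @ cs') (bs @ bs') = lincomb cs bs + lincomb cs' bs'"
  by (simp add: lincomb_def)

lemma scale3_mult_right: "scale3 c (f * g) = f * scale3 c g"
  unfolding scale3_def by (rule mult.left_commute)

lemma lincomb_map_mult: "lincomb cs (map ((*) f) bs) = f * lincomb cs bs"
  by (induction cs bs rule: list_induct2') (simp_all add: scale3_mult_right distrib_left)

lemma lincomb_map_scale: "lincomb (map ((*) a) cs) bs = scale3 a (lincomb cs bs)"
  by (induction cs bs rule: list_induct2') (simp_all add: poly3.scale_right_distrib)

lemma lincomb_sum_nth:
  "length cs = length bs \<Longrightarrow> lincomb cs bs = (\<Sum>i<length bs. scale3 (cs ! i) (bs ! i))"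
  by (simp add: lincomb_def sum_list_sum_nth atLeast0LessThan)

lemma lincomb_in_subspace:
  assumes "poly3.subspace V" "set bs \<subseteq> V"
  shows "lincomb cs bs \<in> V"
  using assms(2)
  by (induction cs bs rule: list_induct2')
    (simp_all add: poly3.subspace_0[OF assms(1)] poly3.subspace_add[OF assms(1)]
      poly3.subspace_scale[OF assms(1)])

definition indep_mod :: "'k::field poly3 set \<Rightarrow> 'k poly3 list \<Rightarrow> bool" where
  "indep_mod U bs \<longleftrightarrow> (\<forall>cs. length cs = length bs \<and> lincomb cs bs \<in> U \<longrightarrow> set cs \<subseteq> {0})"

definition spans_mod :: "'k::field poly3 set \<Rightarrow> 'k poly3 set \<Rightarrow> 'k poly3 list \<Rightarrow> bool" where
  "spans_mod U V bs \<longleftrightarrow> (\<forall>f\<in>V. \<exists>cs. length cs = length bs \<and> f - lincomb cs bs \<in> U)"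

text \<open>
  A repeated entry would give a combination with coefficients \<open>1\<close> and \<open>-1\<close> that vanishes.
\<close>

lemma indep_mod_distinct:
  assumes "0 \<in> U" "indep_mod U bs"
  shows "distinct bs"
  unfolding distinct_conv_nth
proof (intro allI impI notI)
  fix i j assume ij: "i < length bs" "j < length bs" "i \<noteq> j" and eq: "bs ! i = bs ! j"
  define cs where "cs = map (\<lambda>k. if k = i then 1 else if k = j then - 1 else 0 :: 'a) [0..<length bs]"
  have len: "length cs = length bs" by (simp add: cs_def)
  have "lincomb cs bs = (\<Sum>k<length bs. (if k = i then bs ! i else 0) + (if k = j then - (bs ! j) else 0))"
    unfolding lincomb_sum_nth[OF len] using ij by (intro sum.cong) (auto simp: cs_def)
  also have "\<dots> = 0" using ij eq by (simp add: sum.distrib)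
  finally have "lincomb cs bs \<in> U" using assms(1) by simp
  with assms(2) len have "set cs \<subseteq> {0}" by (simp add: indep_mod_def)
  moreover have "cs ! i \<in> set cs" using ij len by auto
  ultimately show False using ij by (auto simp: cs_def)
qed

lemma hilbert_function_eq_length:
  assumes I: "poly3.subspace (I :: 'k::field poly3 set)" and bs: "set bs \<subseteq> homog_part t"
    and ind: "indep_mod (homog_part t \<inter> I) bs"
    and sp: "spans_mod (homog_part t \<inter> I) (homog_part t) bs"
  shows "hilbert_function I t = length bs"
proof -
  have dist: "distinct bs"
    using indep_mod_distinct[OF _ ind] I poly3.subspace_0 subspace_homog_part by blast
  have lc: "(\<Sum>b\<in>set bs. scale3 (c b) b) = lincomb (map c bs) bs" for c :: "'k poly3 \<Rightarrow> 'k"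
  proof -
    have "lincomb (map c bs) bs = (\<Sum>b\<leftarrow>bs. scale3 (c b) b)"
      by (induction bs) simp_all
    then show ?thesis using dist by (simp add: sum_list_distinct_conv_sum_set)
  qed
  have "basis_mod I (homog_part t) (set bs)"
    unfolding basis_mod_def lc
  proof (intro conjI allI impI ballI)
    fix c b assume "lincomb (map c bs) bs \<in> I" and b: "b \<in> set bs"
    then have "lincomb (map c bs) bs \<in> homog_part t \<inter> I"
      using lincomb_in_subspace[OF subspace_homog_part bs] by blast
    then have "set (map c bs) \<subseteq> {0}" using ind unfolding indep_mod_def
      by (metis length_map)
    with b show "c b = 0" by auto
  next
    fix f :: "'k poly3" assume "f \<in> homog_part t"
    then obtain cs where cs: "length cs = length bs" "f - lincomb cs bs \<in> I"
      using sp by (auto simp: spans_mod_def)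
    have "map (\<lambda>b. the (map_of (zip bs cs) b)) bs = cs"
      using cs(1) dist by (intro nth_equalityI) (simp_all add: map_of_zip_nth)
    with cs(2) show "\<exists>c. f - lincomb (map c bs) bs \<in> I" by metis
  qed (use bs in auto)
  then have ex: "\<exists>B. basis_mod I (homog_part t) B \<and> card B = length bs"
    using distinct_card[OF dist] by blast
  then have "n = length bs" if "\<exists>B. basis_mod I (homog_part t) B \<and> card B = n" for n
    using that basis_mod_card[OF I] by (metis add_right_cancel)
  with ex show ?thesis
    unfolding hilbert_function_def by (rule the_equality)
qed

text \<open>
  Gaussian elimination: one equation is used to eliminate a pivot unknown from the others.
\<close>

lemma underdetermined_system:
  fixes a :: "'i \<Rightarrow> 'j \<Rightarrow> 'k::field"
  assumes "finite I" "finite J" "card I < card J"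
  shows "\<exists>c. (\<exists>j\<in>J. c j \<noteq> 0) \<and> (\<forall>i\<in>I. (\<Sum>j\<in>J. c j * a i j) = 0)"
  using assms
proof (induction I arbitrary: J a rule: finite_induct)
  case empty
  then have "J \<noteq> {}" by auto
  then show ?case by (intro exI[of _ "\<lambda>_. 1"]) auto
next
  case (insert i I)
  show ?case
  proof (cases "\<forall>j\<in>J. a i j = 0")
    case True
    obtain c where "\<exists>j\<in>J. c j \<noteq> 0" "\<forall>i\<in>I. (\<Sum>j\<in>J. c j * a i j) = 0"
      using insert.IH[of J a] insert.prems insert.hyps by auto
    with True show ?thesis by (intro exI[of _ c]) auto
  next
    case False
    then obtain p where p: "p \<in> J" "a i p \<noteq> 0" by blast
    have J: "finite (J - {p})" "card I < card (J - {p})"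
      using insert.prems insert.hyps p by (simp_all add: card_Diff_singleton)
    let ?J = "J - {p}" and ?a = "\<lambda>i' j. a i' j - a i j * a i' p / a i p"
    obtain c where c: "\<exists>j\<in>?J. c j \<noteq> 0" "\<forall>i'\<in>I. (\<Sum>j\<in>?J. c j * ?a i' j) = 0"
      using insert.IH[of ?J ?a] J by auto
    define c' where "c' = c(p := - (\<Sum>j\<in>?J. c j * a i j) / a i p)"
    have sum: "(\<Sum>j\<in>J. c' j * a i' j) = c' p * a i' p + (\<Sum>j\<in>?J. c j * a i' j)" for i'
    proof -
      have "(\<Sum>j\<in>?J. c' j * a i' j) = (\<Sum>j\<in>?J. c j * a i' j)"
        by (intro sum.cong) (auto simp: c'_def)
      then show ?thesis using insert.prems p by (simp add: sum.remove)
    qed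
    have "(\<Sum>j\<in>J. c' j * a i' j) = 0" if "i' \<in> I" for i'
    proof -
      have "(\<Sum>j\<in>?J. c j * ?a i' j) =
          (\<Sum>j\<in>?J. c j * a i' j) - (\<Sum>j\<in>?J. c j * a i j) * a i' p / a i p"
        unfolding sum_distrib_right sum_divide_distrib sum_subtractf[symmetric]
        by (intro sum.cong refl) (simp add: right_diff_distrib)
      then show ?thesis using c(2) that unfolding sum by (simp add: c'_def)
    qed
    moreover have "(\<Sum>j\<in>J. c' j * a i j) = 0"
      unfolding sum using p by (simp add: c'_def)
    moreover have "\<exists>j\<in>J. c' j \<noteq> 0" using c(1) by (auto simp: c'_def)
    ultimately show ?thesis by auto
  qed
qed

text \<open>
  If \<open>U\<close> is cut out by at most as many linear conditions as there are vectors in an independent family,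
  then adjoining any \<open>f\<close> to the family makes the conditions underdetermined. The resulting relation must
  involve \<open>f\<close>.
\<close>

lemma spans_mod_by_counting:
  fixes \<phi> :: "'i \<Rightarrow> 'k::field poly3 \<Rightarrow> 'k"
  assumes V: "poly3.subspace V" and bs: "set bs \<subseteq> V"
    and add: "\<And>i f g. i \<in> I \<Longrightarrow> \<phi> i (f + g) = \<phi> i f + \<phi> i g"
    and scale: "\<And>i c f. i \<in> I \<Longrightarrow> \<phi> i (scale3 c f) = c * \<phi> i f"
    and U: "U = {f \<in> V. \<forall>i\<in>I. \<phi> i f = 0}"
    and ind: "indep_mod U bs" and I: "finite I" "card I \<le> length bs"
  shows "spans_mod U V bs"
  unfolding spans_mod_def
proof
  fix f assume f: "f \<in> V"
  have zero: "\<phi> i 0 = 0" if "i \<in> I" for i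
    using scale[OF that, of 0 0] by simp
  have lin: "\<phi> i (lincomb cs vs) = (\<Sum>j<length vs. cs ! j * \<phi> i (vs ! j))"
    if "i \<in> I" "length cs = length vs" for i cs vs
  proof -
    have "\<phi> i (\<Sum>j<n. g j) = (\<Sum>j<n. \<phi> i (g j))" for n :: nat and g
      by (induction n) (simp_all add: that zero add)
    then show ?thesis using that by (simp add: lincomb_sum_nth scale)
  qed
  have "card I < card {..<length (f # bs)}" using I by simp
  then obtain c where c: "\<exists>j<length (f # bs). c j \<noteq> 0"
    "\<forall>i\<in>I. (\<Sum>j<length (f # bs). c j * \<phi> i ((f # bs) ! j)) = 0"
    using underdetermined_system[of I "{..<length (f # bs)}" "\<lambda>i j. \<phi> i ((f # bs) ! j)"] I by auto
  define cs where "cs = map (c \<circ> Suc) [0..<length bs]"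
  have cs: "c 0 # cs = map c [0..<length (f # bs)]"
    by (simp add: cs_def map_upt_Suc del: upt_Suc)
  have "\<phi> i (lincomb (c 0 # cs) (f # bs)) = 0" if "i \<in> I" for i
    using c(2) that unfolding cs by (subst lin) (simp_all del: upt_Suc)
  moreover have "lincomb (c 0 # cs) (f # bs) \<in> V"
    using f bs by (intro lincomb_in_subspace[OF V]) auto
  ultimately have inU: "lincomb (c 0 # cs) (f # bs) \<in> U" by (simp add: U)
  have "poly3.subspace U"
    using V by (auto simp: U poly3.subspace_def add scale zero)
  have "c 0 \<noteq> 0"
  proof
    assume c0: "c 0 = 0"
    with inU have "lincomb cs bs \<in> U" by simp
    moreover have "length cs = length bs" by (simp add: cs_def)
    ultimately have "set cs \<subseteq> {0}" using ind unfolding indep_mod_def by blast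
    with c0 have "set (c 0 # cs) \<subseteq> {0}" by simp
    with c(1) show False unfolding cs by (auto simp: image_subset_iff simp del: upt_Suc)
  qed
  let ?d = "map ((*) (- inverse (c 0))) cs"
  have "f - lincomb ?d bs = scale3 (inverse (c 0)) (lincomb (c 0 # cs) (f # bs))"
    using \<open>c 0 \<noteq> 0\<close> by (simp add: lincomb_map_scale poly3.scale_right_distrib)
  also have "\<dots> \<in> U" using inU \<open>poly3.subspace U\<close> by (rule poly3.subspace_scale[rotated])
  finally show "\<exists>cs. length cs = length bs \<and> f - lincomb cs bs \<in> U"
    by (intro exI[of _ ?d]) (simp add: cs_def)
qed


section \<open>Tangent lines of a conic\<close>

text \<open>
  These are the tangents of the conic $x_1^2 = 4 x_0 x_2$; the indices \<open>1\<close>, \<open>2\<close>, \<open>3\<close> stand for the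
  variables $x_0$, $x_1$, $x_2$. Substituting $(1, a + b, ab)$ gives $(s - a)(s - b)$, which is why
  exactly two of the lines pass through that point.
\<close>

definition tangent :: "nat \<Rightarrow> 'k::field poly3" where
  "tangent s = coord 3 - scale3 (of_nat s) (coord 2) + scale3 ((of_nat s)\<^sup>2) (coord 1)"

text \<open>
  The parameter of a point of the tangent is the quotient $x_1/x_0$, so that \<open>node_param\<close> below is the
  parameter of \<open>node\<close> on either of the two tangents through it.
\<close>

definition tangent_curve :: "nat \<Rightarrow> 3 \<Rightarrow> 'k::field poly" where
  "tangent_curve s j =
     (if j = 1 then 1 else if j = 2 then [:0, 1:] else [:- (of_nat s)\<^sup>2, of_nat s:])"

abbreviation restrict :: "nat \<Rightarrow> 'k::field poly3 \<Rightarrow> 'k poly" where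
  "restrict s \<equiv> pullback (tangent_curve s)"

definition node :: "nat \<times> nat \<Rightarrow> 'k::field ^ 3" where
  "node p = vector [1, of_nat (fst p) + of_nat (snd p), of_nat (fst p) * of_nat (snd p)]"

definition node_param :: "nat \<times> nat \<Rightarrow> 'k::field" where
  "node_param p = of_nat (fst p) + of_nat (snd p)"

definition on_tangent :: "nat \<Rightarrow> (nat \<times> nat) set" where
  "on_tangent s = {p. fst p = s \<or> snd p = s}"

lemma pullback_diff: "pullback g (f - f') = pullback g f - pullback g f'"
  by (metis add_diff_cancel_right' diff_add_cancel pullback_add)

lemma eval3_diff: "eval3 (f - f') v = eval3 f v - eval3 f' v"
  by (simp add: eval3_pullback pullback_diff)

lemma scale3_mult_left: "scale3 c f * g = scale3 c (f * g)"
  unfolding scale3_def by (rule mult.assoc)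

lemma tangent_homog_part: "tangent s \<in> homog_part 1"
  unfolding tangent_def
  by (intro poly3.subspace_add poly3.subspace_diff poly3.subspace_scale
      subspace_homog_part coord_homog_part)

text \<open>
  Two distinct tangents meet transversally: the restriction has a simple zero at their common point.
\<close>

lemma restrict_tangent:
  "restrict r (tangent s) = smult (of_nat r - of_nat s) [:- (of_nat r + of_nat s), 1:]"
  by (simp add: tangent_def tangent_curve_def pullback_add pullback_diff pullback_scale3
      power2_eq_square algebra_simps)

lemma restrict_tangent_self [simp]: "restrict s (tangent s) = 0"
  by (simp add: restrict_tangent)

lemma node_nth [simp]:
  "node p $ 1 = 1" "node p $ 2 = of_nat (fst p) + of_nat (snd p)"
  "node p $ 3 = of_nat (fst p) * of_nat (snd p)"
  by (simp_all add: node_def)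

lemma poly_restrict_node:
  fixes f :: "'k::field poly3"
  assumes "p \<in> on_tangent s"
  shows "poly (restrict s f) (node_param p) = eval3 f (node p)"
proof -
  have "(\<chi> j. poly (tangent_curve s j) (node_param p)) = node p"
    using assms by (auto simp: vec_eq_iff forall_3 tangent_curve_def node_param_def on_tangent_def
        power2_eq_square algebra_simps)
  then show ?thesis unfolding poly_pullback by (rule arg_cong)
qed

lemma eval3_tangent_node:
  "eval3 (tangent s) (node p) = (of_nat s - of_nat (fst p)) * (of_nat s - of_nat (snd p))"
  by (simp add: tangent_def eval3_add eval3_diff eval3_scale3 power2_eq_square algebra_simps)

lemma eval3_tangent_node_eq_0_iff:
  "eval3 (tangent s :: 'k::field_char_0 poly3) (node p) = 0 \<longleftrightarrow> p \<in> on_tangent s"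
  by (auto simp: eval3_tangent_node on_tangent_def)

definition binary_form :: "nat \<Rightarrow> nat \<Rightarrow> 'k::field poly3" where
  "binary_form t a = coord 1 ^ (t - a) * coord 2 ^ a"

lemma binary_form_homog_part: "a \<le> t \<Longrightarrow> binary_form t a \<in> homog_part t"
  using homog_part_mult[OF homog_part_power[OF coord_homog_part[of 1], of "t - a"]
      homog_part_power[OF coord_homog_part[of 2], of a]]
  by (simp add: binary_form_def)

lemma restrict_binary_form: "restrict s (binary_form t a) = monom 1 a"
  by (simp add: binary_form_def pullback_mult pullback_power tangent_curve_def monom_altdef)

text \<open>
  The forms of degree $t - 1$, with the convention that the only form of degree $-1$ is zero.
\<close>

definition homog_pred :: "nat \<Rightarrow> 'k::field poly3 set" where
  "homog_pred t = (case t of 0 \<Rightarrow> {0} | Suc u \<Rightarrow> homog_part u)"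

lemma homog_pred_simps [simp]: "homog_pred 0 = {0}" "homog_pred (Suc u) = homog_part u"
  by (simp_all add: homog_pred_def)

lemma subspace_homog_pred: "poly3.subspace (homog_pred t)"
  by (cases t) (simp_all add: subspace_homog_part)

lemma coord_mult_homog_pred: "g \<in> homog_pred t \<Longrightarrow> coord j * g \<in> homog_pred (Suc t)"
  using homog_part_mult[OF coord_homog_part[of j], of g] poly3.subspace_0[OF subspace_homog_part]
  by (cases t) auto

lemma tangent_mult_homog_pred: "g \<in> homog_pred t \<Longrightarrow> tangent s * g \<in> homog_part t"
  using homog_part_mult[OF tangent_homog_part[of s], of g] poly3.subspace_0[OF subspace_homog_part]
  by (cases t) auto

lemma span_coord_mult:
  assumes "\<And>b. b \<in> B \<Longrightarrow> f * b \<in> poly3.span C" and "w \<in> poly3.span B"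
  shows "f * w \<in> poly3.span C"
proof -
  have "poly3.subspace {w. f * w \<in> poly3.span C}"
    by (auto simp: poly3.subspace_def poly3.span_zero distrib_left poly3.span_add
        poly3.span_scale simp flip: scale3_mult_right)
  with assms have "poly3.span B \<subseteq> {w. f * w \<in> poly3.span C}"
    by (intro poly3.span_minimal) auto
  with assms(2) show ?thesis by blast
qed

text \<open>
  The equation of the line is monic in the last variable, which it therefore allows to eliminate.
\<close>

lemma division_by_tangent_span:
  assumes "f \<in> homog_part t"
  shows "\<exists>w\<in>poly3.span (binary_form t ` {..t}). \<exists>g\<in>homog_pred t. f = w + tangent s * g"
  using assms
proof (induction rule: homog_part_induct)
  case (sum t f g)
  then obtain w h w' h' where "w \<in> poly3.span (binary_form t ` {..t})" "h \<in> homog_pred t"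
    "f = w + tangent s * h" "w' \<in> poly3.span (binary_form t ` {..t})" "h' \<in> homog_pred t"
    "g = w' + tangent s * h'" by blast
  then show ?case
    by (intro bexI[of _ "w + w'"] bexI[of _ "h + h'"])
      (auto simp: algebra_simps poly3.span_add poly3.subspace_add[OF subspace_homog_pred])
next
  case (scale t c f)
  then obtain w h where "w \<in> poly3.span (binary_form t ` {..t})" "h \<in> homog_pred t"
    "f = w + tangent s * h" by blast
  then show ?case
    by (intro bexI[of _ "scale3 c w"] bexI[of _ "scale3 c h"])
      (auto simp: poly3.span_scale poly3.subspace_scale[OF subspace_homog_pred]
        poly3.scale_right_distrib scale3_mult_right)
next
  case one
  have "1 = binary_form 0 0" by (simp add: binary_form_def)
  then show ?case by (auto intro!: poly3.span_base)
next
  case (coord t j f)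
  let ?W = "\<lambda>t. poly3.span (binary_form t ` {..t})"
  obtain w h where w: "w \<in> ?W t" and h: "h \<in> homog_pred t" and f: "f = w + tangent s * h"
    using coord.IH by blast
  have c1: "coord 1 * w \<in> ?W (Suc t)"
  proof (rule span_coord_mult[OF _ w])
    fix b assume "b \<in> binary_form t ` {..t}"
    then obtain a where "a \<le> t" "b = binary_form t a" by auto
    then have "coord 1 * b = binary_form (Suc t) a"
      by (simp only: binary_form_def Suc_diff_le power_Suc mult.assoc)
    with \<open>a \<le> t\<close> show "coord 1 * b \<in> ?W (Suc t)" by (auto intro!: poly3.span_base)
  qed
  have c2: "coord 2 * w \<in> ?W (Suc t)"
  proof (rule span_coord_mult[OF _ w])
    fix b assume "b \<in> binary_form t ` {..t}"
    then obtain a where "a \<le> t" "b = binary_form t a" by auto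
    then have "coord 2 * b = binary_form (Suc t) (Suc a)"
      by (simp only: binary_form_def power_Suc diff_Suc_Suc mult.left_commute)
    with \<open>a \<le> t\<close> show "coord 2 * b \<in> ?W (Suc t)" by (auto intro!: poly3.span_base)
  qed
  have ch: "coord j * h \<in> homog_part t" for j
    using coord_mult_homog_pred[OF h, of j] by simp
  have wt: "w \<in> homog_part t"
  proof -
    have "?W t \<subseteq> homog_part t"
      by (intro poly3.span_minimal) (auto intro: binary_form_homog_part subspace_homog_part)
    with w show ?thesis by blast
  qed
  consider "j = 1" | "j = 2" | "j = 3" using exhaust_3 by blast
  then show ?case
  proof cases
    case 1
    have "coord j * f = coord 1 * w + tangent s * (coord 1 * h)"
      unfolding f \<open>j = 1\<close> distrib_left by (simp only: mult.left_commute)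
    with c1 ch[of 1] show ?thesis by auto
  next
    case 2
    have "coord j * f = coord 2 * w + tangent s * (coord 2 * h)"
      unfolding f \<open>j = 2\<close> distrib_left by (simp only: mult.left_commute)
    with c2 ch[of 2] show ?thesis by auto
  next
    case 3
    \<comment> \<open>Modulo the line, the last variable is a combination of the other two.\<close>
    let ?w = "scale3 (of_nat s) (coord 2 * w) - scale3 ((of_nat s)\<^sup>2) (coord 1 * w)"
    have "coord 3 * f = ?w + tangent s * (w + coord 3 * h)"
    proof -
      have "tangent s * w = coord 3 * w - ?w"
        unfolding tangent_def by (simp add: distrib_right left_diff_distrib scale3_mult_left)
      moreover have "coord 3 * (tangent s * h) = tangent s * (coord 3 * h)"
        by (rule mult.left_commute)
      ultimately show ?thesis unfolding f distrib_left by simp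
    qed
    moreover have "?w \<in> ?W (Suc t)"
      using c1 c2 by (intro poly3.span_diff poly3.span_scale)
    moreover have "w + coord 3 * h \<in> homog_pred (Suc t)"
      using wt ch[of 3] by (simp add: poly3.subspace_add[OF subspace_homog_part])
    ultimately show ?thesis using 3 by blast
  qed
qed

lemma span_set_lincomb:
  assumes "w \<in> poly3.span (set bs)"
  shows "\<exists>cs. length cs = length bs \<and> w = lincomb cs bs"
  using assms
proof (induction bs arbitrary: w)
  case (Cons b bs)
  then obtain k where "w - scale3 k b \<in> poly3.span (set bs)"
    by (auto simp: poly3.span_insert)
  with Cons.IH obtain cs where "length cs = length bs" "w - scale3 k b = lincomb cs bs" by blast
  then show ?case by (intro exI[of _ "k # cs"]) (simp add: algebra_simps)
qed simp

lemma division_by_tangent: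
  assumes "f \<in> homog_part t"
  obtains cs g where "length cs = Suc t" "g \<in> homog_pred t"
    "f = lincomb cs (map (binary_form t) [0..<Suc t]) + tangent s * g"
proof -
  obtain w g where w: "w \<in> poly3.span (binary_form t ` {..t})" "g \<in> homog_pred t"
    "f = w + tangent s * g"
    using division_by_tangent_span[OF assms] by blast
  have "binary_form t ` {..t} = set (map (binary_form t :: nat \<Rightarrow> 'a poly3) [0..<Suc t])"
    by (simp add: atLeast0LessThan lessThan_Suc_atMost del: upt_Suc)
  with w(1) span_set_lincomb obtain cs
    where "length cs = length (map (binary_form t :: nat \<Rightarrow> 'a poly3) [0..<Suc t])"
      "w = lincomb cs (map (binary_form t) [0..<Suc t])" by metis
  with w that show ?thesis by simp
qed

lemma restrict_lincomb_binary_forms: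
  assumes "length cs = n"
  shows "coeff (restrict s (lincomb cs (map (binary_form t) [0..<n]))) i = (if i < n then cs ! i else 0)"
proof -
  have "restrict s (lincomb cs (map (binary_form t) [0..<n])) = (\<Sum>a<n. monom (cs ! a) a)"
    using assms by (simp add: lincomb_sum_nth pullback_sum pullback_scale3 restrict_binary_form smult_monom)
  then show ?thesis by (simp add: coeff_sum)
qed

section \<open>Forms through double and reduced points\<close>

text \<open>
  At a point where two lines meet, a form is singular if and only if it vanishes there and so do its
  derivatives along both lines; \<open>homogeneous_in_ideal_power_2_iff\<close> justifies the definition.
\<close>

definition double_at :: "'k::field poly3 \<Rightarrow> nat \<times> nat \<Rightarrow> bool" where
  "double_at f p \<longleftrightarrow> eval3 f (node p) = 0 \<and>
     poly (pderiv (restrict (fst p) f)) (node_param p) = 0 \<and>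
     poly (pderiv (restrict (snd p) f)) (node_param p) = 0"

definition forms_through ::
    "(nat \<times> nat) set \<Rightarrow> (nat \<times> nat) set \<Rightarrow> nat \<Rightarrow> 'k::field poly3 set" where
  "forms_through D S t =
     {f \<in> homog_part t. (\<forall>p\<in>D. double_at f p) \<and> (\<forall>p\<in>S. eval3 f (node p) = 0)}"

lemma subspace_forms_through: "poly3.subspace (forms_through D S t)"
  using subspace_homog_part[of t]
  by (auto simp: poly3.subspace_def forms_through_def double_at_def eval3_add eval3_scale3
      pullback_add pullback_scale3 pderiv_add pderiv_smult)

text \<open>
  By the product rule, multiplication with the equation of a line turns a zero on the line
  into a singular point. Conversely, the derivative along the other tangent through the point detects
  the value of the cofactor, and away from the line the equation is a unit.
\<close>

lemma double_at_tangent_mult: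
  fixes g :: "'k::field_char_0 poly3"
  assumes "fst p \<noteq> snd p"
  shows "double_at (tangent s * g) p \<longleftrightarrow>
    (if p \<in> on_tangent s then eval3 g (node p) = 0 else double_at g p)"
proof -
  obtain a b where p: "p = (a, b)" by (cases p)
  have ab: "(of_nat a :: 'k) \<noteq> of_nat b" using assms p by simp
  have ev: "poly (restrict a f) (node_param p) = eval3 f (node p)"
      "poly (restrict b f) (node_param p) = eval3 f (node p)" for f :: "'k poly3"
    by (rule poly_restrict_node; simp add: on_tangent_def p)+
  have der: "poly (pderiv (restrict r (tangent s * g))) (node_param p) =
      eval3 (tangent s) (node p) * poly (pderiv (restrict r g)) (node_param p) +
      (of_nat r - of_nat s) * eval3 g (node p)" if "r = a \<or> r = b" for r
  proof -
    have "poly (pderiv (restrict r (tangent s))) x = of_nat r - of_nat s" for x :: 'k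
      by (simp add: restrict_tangent[of r s] pderiv_smult pderiv_pCons)
    with that ev[of "tangent s"] ev[of g] show ?thesis
      by (auto simp: pullback_mult pderiv_mult)
  qed
  show ?thesis
  proof (cases "p \<in> on_tangent s")
    case True
    then have "eval3 (tangent s :: 'k poly3) (node p) = 0"
      by (simp add: eval3_tangent_node_eq_0_iff)
    with True ab show ?thesis
      by (auto simp: double_at_def p eval3_mult der[unfolded p] on_tangent_def)
  next
    case False
    then have "eval3 (tangent s :: 'k poly3) (node p) \<noteq> 0"
      by (simp add: eval3_tangent_node_eq_0_iff)
    with False show ?thesis
      by (auto simp: double_at_def p eval3_mult der[unfolded p])
  qed
qed

text \<open>
  The scheme on the right is the residual of the one on the left: points on the line lose one
  from their multiplicity.
\<close>

lemma tangent_mult_in_forms_through: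
  fixes g :: "'k::field_char_0 poly3"
  assumes "g \<in> homog_part t" "\<forall>p\<in>D. fst p \<noteq> snd p"
  shows "tangent s * g \<in> forms_through D S (Suc t) \<longleftrightarrow>
    g \<in> forms_through (D - on_tangent s) ((S - on_tangent s) \<union> (D \<inter> on_tangent s)) t"
proof -
  have "tangent s * g \<in> homog_part (Suc t)"
    using homog_part_mult[OF tangent_homog_part[of s] assms(1)] by simp
  then show ?thesis
    using assms by (auto simp: forms_through_def double_at_tangent_mult eval3_mult
        eval3_tangent_node_eq_0_iff)
qed

lemma sum_order_le_degree:
  fixes p :: "'k::field poly"
  assumes "p \<noteq> 0" "finite A"
  shows "(\<Sum>x\<in>A. order x p) \<le> degree p"
proof -
  have "(\<Sum>x\<in>A. order x p) = (\<Sum>x\<in>A. count (proots p) x)"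
    using assms by simp
  also have "\<dots> = (\<Sum>x\<in>A \<inter> set_mset (proots p). count (proots p) x)"
    using assms by (intro sum.mono_neutral_right) (auto simp: count_eq_zero_iff simp del: count_proots set_count_proots)
  also have "\<dots> \<le> size (proots p)"
    unfolding size_multiset_overloaded_eq by (intro sum_mono2) auto
  also have "\<dots> \<le> degree p" by (rule size_proots_le)
  finally show ?thesis .
qed

lemma order_ge_2:
  fixes p :: "'k::field poly"
  assumes "p \<noteq> 0" "poly p a = 0" "poly (pderiv p) a = 0"
  shows "2 \<le> order a p"
proof -
  obtain q where q: "p = [:- a, 1:] * q" using assms(2) by (auto simp: poly_eq_0_iff_dvd)
  have "poly q a = 0" using assms(3) unfolding q pderiv_mult by (simp add: pderiv_pCons)
  then obtain r where "q = [:- a, 1:] * r" by (auto simp: poly_eq_0_iff_dvd)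
  then have "[:- a, 1:] ^ 2 dvd p"
    by (simp only: q power2_eq_square mult.assoc[symmetric] dvd_triv_left)
  then show ?thesis using assms(1) order_divides by blast
qed

lemma inj_on_node_param:
  "inj_on (node_param :: _ \<Rightarrow> 'k::field_char_0) {p \<in> on_tangent s. fst p < snd p}"
  unfolding inj_on_def node_param_def of_nat_add[symmetric] of_nat_eq_iff
  by (auto simp: on_tangent_def)

text \<open>
  This is Bezout for a line: double points of the scheme are double roots of the restriction, and
  different points of the line have different parameters.
\<close>

lemma restrict_degree_bound:
  fixes f :: "'k::field_char_0 poly3"
  assumes f: "f \<in> forms_through D S t" and nz: "restrict s f \<noteq> 0"
    and fin: "finite D" "finite S" and disj: "D \<inter> S = {}"
    and less: "\<forall>p\<in>D \<union> S. fst p < snd p"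
  shows "2 * card (D \<inter> on_tangent s) + card (S \<inter> on_tangent s) \<le> degree (restrict s f)"
proof -
  let ?D = "D \<inter> on_tangent s" and ?S = "S \<inter> on_tangent s"
  let ?o = "\<lambda>p. order (node_param p) (restrict s f)"
  have "2 * card ?D + card ?S = (\<Sum>p\<in>?D. 2) + (\<Sum>p\<in>?S. 1)" by simp
  also have "\<dots> \<le> (\<Sum>p\<in>?D. ?o p) + (\<Sum>p\<in>?S. ?o p)"
  proof (intro add_mono sum_mono)
    fix p assume p: "p \<in> ?D"
    with f have "double_at f p" by (auto simp: forms_through_def)
    with p show "2 \<le> ?o p"
      by (intro order_ge_2 nz) (auto simp: poly_restrict_node double_at_def on_tangent_def)
  next
    fix p assume p: "p \<in> ?S"
    with f have "poly (restrict s f) (node_param p) = 0"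
      by (auto simp: forms_through_def poly_restrict_node)
    with nz show "1 \<le> ?o p" by (simp add: order_root Suc_le_eq)
  qed
  also have "\<dots> = (\<Sum>p\<in>?D \<union> ?S. ?o p)"
    using fin disj by (intro sum.union_disjoint[symmetric]) auto
  also have "\<dots> = (\<Sum>x\<in>node_param ` (?D \<union> ?S). order x (restrict s f))"
    by (subst sum.reindex) (use less in \<open>auto intro: inj_on_subset[OF inj_on_node_param[of s]]\<close>)
  also have "\<dots> \<le> degree (restrict s f)"
    using fin by (intro sum_order_le_degree nz) auto
  finally show ?thesis .
qed

section \<open>Reduction along lines\<close>

text \<open>
  The lines are removed one after the other; \<open>ds\<close> records the degrees of the intersections of
  the successive residual schemes with them, and the last residual scheme is empty.
\<close>

inductive full_reduction ::
    "(nat \<times> nat) set \<Rightarrow> (nat \<times> nat) set \<Rightarrow> nat list \<Rightarrow> nat list \<Rightarrow> bool" where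
  full_reduction_Nil: "full_reduction {} {} [] []"
| full_reduction_Cons:
    "full_reduction (D - on_tangent s) ((S - on_tangent s) \<union> (D \<inter> on_tangent s)) ss ds \<Longrightarrow>
     d = 2 * card (D \<inter> on_tangent s) + card (S \<inter> on_tangent s) \<Longrightarrow>
     full_reduction D S (s # ss) (d # ds)"

text \<open>
  The value in degree \<open>t\<close> of the Hilbert function of a scheme whose successive intersections have
  the given degrees: the first line contributes binary forms of degree \<open>t\<close>, and the residual scheme
  is evaluated in degree $t - 1$.
\<close>

fun staircase :: "nat list \<Rightarrow> nat \<Rightarrow> nat" where
  "staircase [] t = 0"
| "staircase (d # ds) t = min d (Suc t) + (case t of 0 \<Rightarrow> 0 | Suc u \<Rightarrow> staircase ds u)"

text \<open>
  The bound $d \le t + 1$ passes to the next line because the entries decrease by at least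
  one while \<open>t\<close> drops by exactly one.
\<close>

lemma staircase_saturated:
  assumes "sorted_wrt (>) ds" "\<forall>d\<in>set ds. d \<le> Suc t"
  shows "staircase ds t = sum_list ds"
  using assms
proof (induction ds arbitrary: t)
  case (Cons d ds)
  show ?case
  proof (cases t)
    case 0
    with Cons.prems have "\<forall>x\<in>set ds. x = 0" by force
    then have "sum_list ds = 0" by simp
    with 0 Cons.prems show ?thesis by simp
  next
    case (Suc u)
    with Cons.prems have "\<forall>x\<in>set ds. x \<le> Suc u" by fastforce
    with Cons.IH[of u] Cons.prems Suc show ?thesis by simp
  qed
qed simp

text \<open>
  A double point contributes two to the line that first meets it, and then it counts as a reduced point.
\<close>

lemma full_reduction_degree:
  assumes "full_reduction D S ss ds" "finite D" "finite S" "D \<inter> S = {}"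
  shows "sum_list ds = 3 * card D + card S"
  using assms
proof (induction rule: full_reduction.induct)
  case (full_reduction_Cons D s S ss ds d)
  let ?l = "on_tangent s"
  have "card D = card (D - ?l) + card (D \<inter> ?l)" "card S = card (S - ?l) + card (S \<inter> ?l)"
    using full_reduction_Cons.prems by (metis add.commute card_Int_Diff)+
  moreover have "card ((S - ?l) \<union> (D \<inter> ?l)) = card (S - ?l) + card (D \<inter> ?l)"
    using full_reduction_Cons.prems by (intro card_Un_disjoint) auto
  moreover have "sum_list ds = 3 * card (D - ?l) + card ((S - ?l) \<union> (D \<inter> ?l))"
    using full_reduction_Cons.prems by (intro full_reduction_Cons.IH) auto
  ultimately show ?case using full_reduction_Cons.hyps(2) by simp
qed simp

lemma spans_mod_forms_through:
  fixes bs :: "'k::field_char_0 poly3 list"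
  assumes fin: "finite D" "finite S" and bs: "set bs \<subseteq> homog_part t"
    and ind: "indep_mod (forms_through D S t) bs" and len: "3 * card D + card S \<le> length bs"
  shows "spans_mod (forms_through D S t) (homog_part t) bs"
proof (rule spans_mod_by_counting[OF subspace_homog_part bs _ _ _ ind])
  let ?\<phi> = "\<lambda>(j, p) f. if j = (0::nat) then eval3 f (node p)
    else poly (pderiv (restrict (if j = 1 then fst p else snd p) f)) (node_param p) :: 'k"
  let ?I = "({0, 1, 2 :: nat} \<times> D) \<union> ({0} \<times> S)"
  show "?\<phi> i (f + g) = ?\<phi> i f + ?\<phi> i g" for i f g
    by (auto simp: eval3_add pullback_add pderiv_add split: prod.splits)
  show "?\<phi> i (scale3 c f) = c * ?\<phi> i f" for i c f
    by (auto simp: eval3_scale3 pullback_scale3 pderiv_smult split: prod.splits)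
  show "forms_through D S t = {f \<in> homog_part t. \<forall>i\<in>?I. ?\<phi> i f = 0}"
    by (auto simp: forms_through_def double_at_def ball_Un split_paired_Ball_Sigma)
  show "finite ?I" using fin by simp
  have "card ?I \<le> card ({0, 1, 2::nat} \<times> D) + card ({0::nat} \<times> S)"
    by (rule card_Un_le)
  with len show "card ?I \<le> length bs" by (simp add: card_cartesian_product)
qed

text \<open>
  The basis consists of $\min(d, t+1)$ monomials in the first two variables, which restrict to powers
  of the parameter on the first line, followed by the products of its equation with a basis for the
  residual scheme in degree $t - 1$. Independence is seen on the line: a polynomial of degree
  less than $d$ with $d$ roots vanishes, after which the equation of the line can be
  cancelled. Spanning comes from division if $t < d$ and from counting conditions otherwise.
\<close>

lemma full_reduction_basis:
  assumes "full_reduction D S ss ds" "finite D" "finite S" "D \<inter> S = {}"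
    "\<forall>p\<in>D \<union> S. fst p < snd p" "sorted_wrt (>) ds"
  shows "\<exists>bs :: 'k::field_char_0 poly3 list. set bs \<subseteq> homog_part t \<and> length bs = staircase ds t \<and>
    indep_mod (forms_through D S t) bs \<and> spans_mod (forms_through D S t) (homog_part t) bs"
  using assms
proof (induction arbitrary: t rule: full_reduction.induct)
  case full_reduction_Nil
  then show ?case
    by (intro exI[of _ "[]"]) (auto simp: indep_mod_def spans_mod_def forms_through_def)
next
  case (full_reduction_Cons D s S ss ds d)
  let ?D = "D - on_tangent s" and ?S = "(S - on_tangent s) \<union> (D \<inter> on_tangent s)"
  have ne: "\<forall>p\<in>D. fst p \<noteq> snd p"
    using full_reduction_Cons.prems(4) by (metis UnI1 less_irrefl)
  \<comment> \<open>The induction hypothesis, phrased so that it includes degree zero, where the residual part is empty.\<close>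
  have "\<exists>bs :: 'k poly3 list. set bs \<subseteq> homog_pred t \<and> length bs = (case t of 0 \<Rightarrow> 0 | Suc u \<Rightarrow> staircase ds u) \<and>
    (\<forall>cs. length cs = length bs \<and> tangent s * lincomb cs bs \<in> forms_through D S t \<longrightarrow> set cs \<subseteq> {0}) \<and>
    (\<forall>g\<in>homog_pred t. \<exists>cs. length cs = length bs \<and> tangent s * (g - lincomb cs bs) \<in> forms_through D S t)"
  proof (cases t)
    case 0
    then show ?thesis
      by (intro exI[of _ "[]"]) (auto simp: poly3.subspace_0[OF subspace_forms_through])
  next
    case (Suc u)
    obtain bs :: "'k poly3 list" where bs: "set bs \<subseteq> homog_part u" "length bs = staircase ds u"
      "indep_mod (forms_through ?D ?S u) bs" "spans_mod (forms_through ?D ?S u) (homog_part u) bs"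
      using full_reduction_Cons.IH[of u] full_reduction_Cons.prems by auto
    have lc: "lincomb cs bs \<in> homog_part u" for cs
      using lincomb_in_subspace[OF subspace_homog_part bs(1)] .
    have iff: "tangent s * g \<in> forms_through D S t \<longleftrightarrow> g \<in> forms_through ?D ?S u"
      if "g \<in> homog_part u" for g :: "'k poly3"
      using tangent_mult_in_forms_through[OF that ne] Suc by simp
    show ?thesis
    proof (intro exI[of _ bs] conjI allI impI ballI)
      fix cs assume "length cs = length bs \<and> tangent s * lincomb cs bs \<in> forms_through D S t"
      then show "set cs \<subseteq> {0}" using bs(3) iff[OF lc] unfolding indep_mod_def by blast
    next
      fix g :: "'k poly3" assume g: "g \<in> homog_pred t"
      then obtain cs where "length cs = length bs" "g - lincomb cs bs \<in> forms_through ?D ?S u"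
        using bs(4) Suc by (auto simp: spans_mod_def)
      moreover have "g - lincomb cs bs \<in> homog_part u" for cs
        using g Suc lc by (simp add: poly3.subspace_diff[OF subspace_homog_part])
      ultimately show "\<exists>cs. length cs = length bs \<and>
          tangent s * (g - lincomb cs bs) \<in> forms_through D S t"
        using iff by blast
    qed (use bs Suc in simp_all)
  qed
  then obtain bs :: "'k poly3 list" where bs: "set bs \<subseteq> homog_pred t"
      "length bs = (case t of 0 \<Rightarrow> 0 | Suc u \<Rightarrow> staircase ds u)"
    and ind: "\<And>cs. length cs = length bs \<Longrightarrow>
      tangent s * lincomb cs bs \<in> forms_through D S t \<Longrightarrow> set cs \<subseteq> {0}"
    and sp: "\<And>g. g \<in> homog_pred t \<Longrightarrow> \<exists>cs. length cs = length bs \<and>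
      tangent s * (g - lincomb cs bs) \<in> forms_through D S t"
    by blast
  define j where "j = min d (Suc t)"
  let ?b = "map (binary_form t :: nat \<Rightarrow> 'k poly3) [0..<j]"
  let ?bs = "?b @ map ((*) (tangent s)) bs"
  have hom: "set ?bs \<subseteq> homog_part t"
    using bs(1) by (auto simp: j_def intro: binary_form_homog_part tangent_mult_homog_pred)
  have len: "length ?bs = staircase (d # ds) t" by (simp add: bs j_def)
  have indep: "indep_mod (forms_through D S t) ?bs"
    unfolding indep_mod_def
  proof (intro allI impI, elim conjE)
    fix cs assume l: "length cs = length ?bs" and inf: "lincomb cs ?bs \<in> forms_through D S t"
    define c1 c2 where "c1 = take j cs" and "c2 = drop j cs"
    have cs: "cs = c1 @ c2" and l1: "length c1 = j" and l2: "length c2 = length bs"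
      using l by (simp_all add: c1_def c2_def)
    have eq: "lincomb cs ?bs = lincomb c1 ?b + tangent s * lincomb c2 bs"
      unfolding cs using l1 by (simp add: lincomb_append lincomb_map_mult)
    then have r: "restrict s (lincomb cs ?bs) = restrict s (lincomb c1 ?b)"
      by (simp add: pullback_add pullback_mult)
    note co = restrict_lincomb_binary_forms[OF l1, of s t]
    have "restrict s (lincomb cs ?bs) = 0"
    proof (rule ccontr)
      assume nz: "restrict s (lincomb cs ?bs) \<noteq> 0"
      with full_reduction_Cons.prems full_reduction_Cons.hyps(2)
      have "d \<le> degree (restrict s (lincomb cs ?bs))"
        using restrict_degree_bound[OF inf nz] by simp
      moreover have "degree (restrict s (lincomb cs ?bs)) < j"
        using nz co unfolding r by (metis leading_coeff_0_iff)
      ultimately show False by (simp add: j_def)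
    qed
    with co have "c1 ! i = 0" if "i < j" for i using that unfolding r by (metis coeff_0)
    then have c1: "c1 = replicate j 0" using l1 by (intro nth_equalityI) auto
    have "lincomb c1 ?b = 0" unfolding c1 by (simp add: lincomb_sum_nth)
    with eq inf l2 have "set c2 \<subseteq> {0}" by (intro ind) simp_all
    then show "set cs \<subseteq> {0}" unfolding cs c1 by auto
  qed
  have "spans_mod (forms_through D S t) (homog_part t) ?bs"
  proof (cases "Suc t \<le> d")
    case True
    then have j: "j = Suc t" by (simp add: j_def)
    show ?thesis
      unfolding spans_mod_def
    proof
      fix f :: "'k poly3" assume "f \<in> homog_part t"
      then obtain c1 g where c1: "length c1 = Suc t" and g: "g \<in> homog_pred t"
        and f: "f = lincomb c1 (map (binary_form t) [0..<Suc t]) + tangent s * g"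
        by (rule division_by_tangent)
      from sp[OF g] obtain c2 where c2: "length c2 = length bs"
        "tangent s * (g - lincomb c2 bs) \<in> forms_through D S t" by blast
      have "f - lincomb (c1 @ c2) ?bs = tangent s * (g - lincomb c2 bs)"
        using c1 unfolding f j
        by (simp add: lincomb_append lincomb_map_mult right_diff_distrib del: upt_Suc)
      with c1 c2 show "\<exists>cs. length cs = length ?bs \<and> f - lincomb cs ?bs \<in> forms_through D S t"
        by (intro exI[of _ "c1 @ c2"]) (simp add: j)
    qed
  next
    case False
    have "staircase (d # ds) t = sum_list (d # ds)"
      using False full_reduction_Cons.prems by (intro staircase_saturated) force+
    also have "\<dots> = 3 * card D + card S"
      using full_reduction_Cons.prems full_reduction.full_reduction_Cons[OF full_reduction_Cons.hyps]
      by (intro full_reduction_degree) auto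
    finally show ?thesis
      using full_reduction_Cons.prems len
      by (intro spans_mod_forms_through hom indep) simp_all
  qed
  with hom len indep show ?case by blast
qed

section \<open>The ideal of the fat points\<close>

lemma ideal_of_vanishing:
  "ring_ideal.subspace {f. eval3 f v = (0 :: 'k::comm_ring_1)}"
  by (simp add: ring_ideal.subspace_def eval3_add eval3_mult)

definition proj_node :: "nat \<times> nat \<Rightarrow> ('k::field ^ 3) set" where
  "proj_node p = {v. \<exists>c. c \<noteq> 0 \<and> v = c *s node p}"

lemma node_nonzero: "node p \<noteq> 0"
  by (metis node_nth(1) zero_index zero_neq_one)

lemma proj_node_in_proj_plane: "(proj_node p :: ('k::field ^ 3) set) \<in> proj_plane"
proof -
  let ?R = "{(v, w). v \<noteq> 0 \<and> w \<noteq> (0 :: 'k ^ 3) \<and> (\<exists>c. c \<noteq> 0 \<and> w = c *s v)}"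
  have "?R `` {node p} \<in> {v. v \<noteq> 0} // ?R"
    by (rule quotientI) (simp add: node_nonzero)
  moreover have "proj_node p = ?R `` {node p}"
    by (auto simp: proj_node_def node_nonzero)
  ultimately show ?thesis
    unfolding proj_plane_def by (simp only:)
qed

lemma node_in_proj_node: "node p \<in> proj_node p"
  unfolding proj_node_def by (rule CollectI, rule exI[of _ 1]) simp

text \<open>
  A point remembers the two tangents through it.
\<close>

lemma inj_on_proj_node:
  "inj_on (proj_node :: _ \<Rightarrow> ('k::field_char_0 ^ 3) set) {p. fst p < snd p}"
proof (rule inj_onI)
  fix p q :: "nat \<times> nat"
  assume p: "p \<in> {p. fst p < snd p}" and q: "q \<in> {p. fst p < snd p}"
    and "(proj_node p :: ('k ^ 3) set) = proj_node q"
  then have "(node p :: 'k ^ 3) \<in> proj_node q" using node_in_proj_node by metis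
  then obtain c where "(node p :: 'k ^ 3) = c *s node q" by (auto simp: proj_node_def)
  moreover from this have "c = 1" by (metis mult.right_neutral node_nth(1) vector_smult_component)
  ultimately have eq: "(node p :: 'k ^ 3) = node q" by simp
  have "eval3 (tangent s :: 'k poly3) (node p) = eval3 (tangent s) (node q)" for s
    unfolding eq ..
  then have "p \<in> on_tangent s \<longleftrightarrow> q \<in> on_tangent s" for s
    by (metis eval3_tangent_node_eq_0_iff)
  from this[of "fst p"] this[of "snd p"] p q show "p = q"
    by (auto simp: on_tangent_def prod_eq_iff)
qed

lemma point_ideal_eval:
  assumes "f \<in> point_ideal (proj_node p)"
  shows "eval3 f (node p) = 0"
proof -
  have "point_ideal (proj_node p) \<subseteq> {f. eval3 f (node p) = 0}"
    unfolding point_ideal_def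
    by (intro ring_ideal.span_minimal ideal_of_vanishing) (auto intro: node_in_proj_node)
  with assms show ?thesis by blast
qed

lemma homogeneous_in_point_ideal_iff:
  fixes f :: "'k::field poly3"
  assumes "f \<in> homog_part t"
  shows "f \<in> point_ideal (proj_node p) \<longleftrightarrow> eval3 f (node p) = 0"
proof
  assume "eval3 f (node p) = 0"
  then have "\<forall>v\<in>proj_node p. eval3 f v = 0"
    using eval3_homogeneous[OF assms] by (auto simp: proj_node_def)
  with assms show "f \<in> point_ideal (proj_node p)"
    unfolding point_ideal_def by (intro ring_ideal.span_base) blast
qed (rule point_ideal_eval)

lemma ideal_power_1: "ideal_power (point_ideal P) 1 = point_ideal P"
proof -
  have "f \<in> {prod_list fs | fs. length fs = 1 \<and> set fs \<subseteq> point_ideal P}"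
    if "f \<in> point_ideal P" for f
    using that by (intro CollectI exI[of _ "[f]"]) simp
  then have "{prod_list fs | fs. length fs = 1 \<and> set fs \<subseteq> point_ideal P} = point_ideal P"
    by (auto simp: length_Suc_conv)
  then show ?thesis
    unfolding ideal_power_def by (simp add: point_ideal_def ring_ideal.span_span)
qed

lemma ideal_power_2_mult: "f \<in> I \<Longrightarrow> g \<in> I \<Longrightarrow> f * g \<in> ideal_power I 2"
  unfolding ideal_power_def
  by (rule ring_ideal.span_base, rule CollectI, rule exI[of _ "[f, g]"]) simp

lemma ideal_power_2_double_at:
  fixes f :: "'k::field poly3"
  assumes "f \<in> ideal_power (point_ideal (proj_node p)) 2"
  shows "double_at f p"
proof -
  let ?d = "\<lambda>s f. poly (pderiv (restrict s f)) (node_param p) :: 'k"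
  have ev: "poly (restrict s f) (node_param p) = eval3 f (node p)"
    if "s = fst p \<or> s = snd p" for s and f :: "'k poly3"
    using that by (intro poly_restrict_node) (auto simp: on_tangent_def)
  have der: "?d s (f * g) = eval3 f (node p) * ?d s g + eval3 g (node p) * ?d s f"
    if "s = fst p \<or> s = snd p" for s f g
    using ev[OF that] by (simp add: pullback_mult pderiv_mult)
  have "ring_ideal.subspace {f :: 'k poly3. double_at f p}"
    by (auto simp: ring_ideal.subspace_def double_at_def eval3_add eval3_mult der pullback_add
        pderiv_add)
  moreover have "double_at (prod_list fs) p"
    if len: "length fs = 2" and sub: "set fs \<subseteq> point_ideal (proj_node p)" for fs :: "'k poly3 list"
  proof -
    obtain f g where fs: "fs = [f, g]" using len by (auto simp: length_Suc_conv numeral_2_eq_2)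
    with sub have "eval3 f (node p) = 0" "eval3 g (node p) = 0"
      by (auto intro: point_ideal_eval)
    then show ?thesis by (simp add: fs double_at_def eval3_mult der)
  qed
  ultimately have "ideal_power (point_ideal (proj_node p)) 2 \<subseteq> {f :: 'k poly3. double_at f p}"
    unfolding ideal_power_def by (intro ring_ideal.span_minimal) auto
  with assms show ?thesis by blast
qed

text \<open>
  Modulo two distinct lines through the point, all coordinates are multiples of the first one, so that
  a form reduces to a multiple of a power of it. The factor is the value at the point.
\<close>

lemma tangents_generate_point_ideal:
  fixes f :: "'k::field_char_0 poly3"
  assumes f: "f \<in> homog_part t" and zero: "eval3 f (node (a, b)) = 0" and ab: "a \<noteq> b"
  obtains g h where "g \<in> homog_pred t" "h \<in> homog_pred t" "f = tangent a * g + tangent b * h"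
proof -
  have "\<exists>c. \<exists>g\<in>homog_pred t. \<exists>h\<in>homog_pred t.
      f = scale3 c (coord 1 ^ t) + tangent a * g + tangent b * h"
    using f
  proof (induction rule: homog_part_induct)
    case (sum t f f')
    then obtain c g h c' g' h' where 1: "g \<in> homog_pred t" "h \<in> homog_pred t"
      "f = scale3 c (coord 1 ^ t) + tangent a * g + tangent b * h"
      "g' \<in> homog_pred t" "h' \<in> homog_pred t"
      "f' = scale3 c' (coord 1 ^ t) + tangent a * g' + tangent b * h'" by blast
    then have "f + f' = scale3 (c + c') (coord 1 ^ t) + tangent a * (g + g') + tangent b * (h + h')"
      by (simp add: poly3.scale_left_distrib distrib_left)
    with 1 show ?case using poly3.subspace_add[OF subspace_homog_pred] by blast
  next
    case (scale t c f)
    then obtain c' g h where 1: "g \<in> homog_pred t" "h \<in> homog_pred t"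
      "f = scale3 c' (coord 1 ^ t) + tangent a * g + tangent b * h" by blast
    then have "scale3 c f = scale3 (c * c') (coord 1 ^ t) + tangent a * scale3 c g + tangent b * scale3 c h"
      by (simp add: poly3.scale_right_distrib scale3_mult_right)
    with 1 show ?case using poly3.subspace_scale[OF subspace_homog_pred] by blast
  next
    case one
    then show ?case by (intro exI[of _ 1]) simp
  next
    case (coord t j f)
    then obtain c g h where g: "g \<in> homog_pred t" and h: "h \<in> homog_pred t"
      and f: "f = scale3 c (coord 1 ^ t) + tangent a * g + tangent b * h" by blast
    \<comment> \<open>Here \<open>u\<close> comes from the relation that the difference of the two tangents is
      \<open>b - a\<close> times the equation of the line joining the point to the point \<open>(0 : 0 : 1)\<close>.\<close>
    have "\<exists>e x y. coord j = scale3 e (coord 1) + scale3 x (tangent a) + scale3 y (tangent b :: 'k poly3)"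
    proof -
      let ?A = "of_nat a :: 'k" and ?B = "of_nat b :: 'k"
      define u where "u = inverse (?B - ?A)"
      have u: "u * (?B - ?A) = 1" using ab by (simp add: u_def)
      have 2: "coord 2 = scale3 (?A + ?B) (coord 1) + scale3 u (tangent a) + scale3 (- u) (tangent b)"
      proof -
        have "scale3 u (tangent a) + scale3 (- u) (tangent b) =
          scale3 (u * (?B - ?A)) (coord 2) - scale3 (u * (?B - ?A) * (?A + ?B)) (coord 1)"
          by (simp add: tangent_def poly3.scale_right_distrib poly3.scale_right_diff_distrib
              poly3.scale_left_diff_distrib poly3.scale_left_distrib algebra_simps power2_eq_square)
        then show ?thesis unfolding add.assoc u by simp
      qed
      have 3: "coord 3 = scale3 (?A * ?B) (coord 1) + scale3 (1 + ?A * u) (tangent a)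
          + scale3 (- (?A * u)) (tangent b)"
      proof -
        have "coord 3 = tangent a + scale3 ?A (coord 2) - scale3 (?A\<^sup>2) (coord 1)"
          by (simp add: tangent_def)
        then show ?thesis
          unfolding 2 by (simp add: poly3.scale_right_distrib poly3.scale_left_distrib
              algebra_simps power2_eq_square)
      qed
      have 1: "coord 1 = scale3 1 (coord 1) + scale3 0 (tangent a) + scale3 0 (tangent b :: 'k poly3)"
        by simp
      show ?thesis using exhaust_3[of j] 1 2 3 by blast
    qed
    then obtain e x y where j:
      "coord j = scale3 e (coord 1) + scale3 x (tangent a) + scale3 y (tangent b :: 'k poly3)"
      by blast
    let ?p = "scale3 c (coord 1 ^ t)"
    have p: "?p \<in> homog_part t"
      using homog_part_power[OF coord_homog_part[of 1], of t]
      by (intro poly3.subspace_scale[OF subspace_homog_part]) simp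
    have "coord j * f = coord j * ?p + tangent a * (coord j * g) + tangent b * (coord j * h)"
      unfolding f by (simp add: distrib_left mult.left_commute)
    also have "coord j * ?p = scale3 (e * c) (coord 1 ^ Suc t)
        + tangent a * scale3 x ?p + tangent b * scale3 y ?p"
      unfolding j distrib_right scale3_mult_left scale3_mult_right[symmetric]
      by (simp add: poly3.scale_right_distrib mult.commute[of c])
    finally have "coord j * f = scale3 (e * c) (coord 1 ^ Suc t) + tangent a * (scale3 x ?p + coord j * g)
        + tangent b * (scale3 y ?p + coord j * h)"
      by (simp add: distrib_left)
    moreover have "scale3 x ?p + coord j * g \<in> homog_pred (Suc t)"
      "scale3 y ?p + coord j * h \<in> homog_pred (Suc t)"
      using coord_mult_homog_pred[OF g, of j] coord_mult_homog_pred[OF h, of j]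
      unfolding homog_pred_simps
      by (blast intro: poly3.subspace_add[OF subspace_homog_part]
          poly3.subspace_scale[OF subspace_homog_part p])+
    ultimately show ?case by blast
  qed
  then obtain c g h where g: "g \<in> homog_pred t" "h \<in> homog_pred t"
    and f': "f = scale3 c (coord 1 ^ t) + tangent a * g + tangent b * h" by blast
  have "eval3 (tangent a :: 'k poly3) (node (a, b)) = 0" "eval3 (tangent b :: 'k poly3) (node (a, b)) = 0"
    by (simp_all add: eval3_tangent_node)
  moreover have "eval3 (coord 1 ^ t) (node (a, b)) = (1 :: 'k)"
    by (simp add: eval3_pullback pullback_power)
  ultimately have "c = 0"
    using zero unfolding f' by (simp add: eval3_add eval3_scale3 eval3_mult)
  with f' g that show ?thesis by simp
qed

text \<open>
  Write the form as a combination of the two tangents. Along either tangent only the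
  summand with the other one survives to first order, so that the cofactors vanish at the point and lie
  in its ideal.
\<close>

lemma homogeneous_in_ideal_power_2_iff:
  fixes f :: "'k::field_char_0 poly3"
  assumes f: "f \<in> homog_part t" and p: "fst p \<noteq> snd p"
  shows "f \<in> ideal_power (point_ideal (proj_node p)) 2 \<longleftrightarrow> double_at f p"
proof
  assume d: "double_at f p"
  obtain a b where ab: "p = (a, b)" by (cases p)
  let ?I = "point_ideal (proj_node p) :: 'k poly3 set"
  obtain g h where g: "g \<in> homog_pred t" and h: "h \<in> homog_pred t"
    and eq: "f = tangent a * g + tangent b * h"
    using tangents_generate_point_ideal[OF f, of a b] d p by (auto simp: double_at_def ab)
  have ev: "poly (restrict a f) (node_param p) = eval3 f (node p)"
    "poly (restrict b f) (node_param p) = eval3 f (node p)" for f :: "'k poly3"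
    by (rule poly_restrict_node; simp add: on_tangent_def ab)+
  have der: "poly (pderiv (restrict r (tangent s))) x = of_nat r - of_nat s" for r s and x :: 'k
    by (simp add: restrict_tangent[of r s] pderiv_smult pderiv_pCons)
  have tan: "tangent a \<in> ?I" "tangent b \<in> ?I"
    by (simp_all add: homogeneous_in_point_ideal_iff[OF tangent_homog_part] eval3_tangent_node ab)
  have t0: "eval3 (tangent a :: 'k poly3) (node p) = 0" "eval3 (tangent b :: 'k poly3) (node p) = 0"
    by (simp_all add: eval3_tangent_node ab)
  have "(of_nat a - of_nat b) * eval3 h (node p) = 0"
    using d ev[of "tangent b"] ev[of h] ev[of "tangent a"] ev[of g] t0
    by (auto simp: double_at_def ab eq pullback_add pullback_mult pderiv_add pderiv_mult der)
  then have h0: "eval3 h (node p) = 0" using p ab by simp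
  have "(of_nat b - of_nat a) * eval3 g (node p) = 0"
    using d ev[of "tangent a"] ev[of g] ev[of "tangent b"] ev[of h] t0
    by (auto simp: double_at_def ab eq pullback_add pullback_mult pderiv_add pderiv_mult der)
  then have g0: "eval3 g (node p) = 0" using p ab by simp
  have in_I: "k \<in> ?I" if "k \<in> homog_pred t" "eval3 k (node p) = 0" for k
  proof (cases t)
    case 0
    with that(1) show ?thesis by (simp add: point_ideal_def ring_ideal.span_zero)
  next
    case (Suc u)
    with that show ?thesis using homogeneous_in_point_ideal_iff[of k u p] by simp
  qed
  have "tangent a * g \<in> ideal_power ?I 2" "tangent b * h \<in> ideal_power ?I 2"
    using in_I[OF g g0] in_I[OF h h0] tan by (auto intro: ideal_power_2_mult)
  then show "f \<in> ideal_power ?I 2"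
    unfolding eq ideal_power_def by (rule ring_ideal.span_add)
qed (rule ideal_power_2_double_at)

definition fat_nodes :: "(nat \<times> nat) set \<Rightarrow> (nat \<times> nat) set \<Rightarrow> ('k::field ^ 3) set multiset" where
  "fat_nodes D S = repeat_mset 2 (mset_set (proj_node ` D)) + mset_set (proj_node ` S)"

lemma count_fat_nodes:
  fixes p :: "nat \<times> nat"
  assumes "finite D" "finite S" "D \<inter> S = {}" "\<forall>p\<in>D \<union> S. fst p < snd p"
  shows "p \<in> D \<Longrightarrow> count (fat_nodes D S :: ('k::field_char_0 ^ 3) set multiset) (proj_node p) = 2"
    and "p \<in> S \<Longrightarrow> count (fat_nodes D S :: ('k::field_char_0 ^ 3) set multiset) (proj_node p) = 1"
proof -
  have *: "(proj_node p :: ('k ^ 3) set) \<in> proj_node ` A \<longleftrightarrow> p \<in> A"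
    if "p \<in> D \<union> S" "A \<subseteq> D \<union> S" for p A
    using that assms(4) inj_on_image_mem_iff[OF inj_on_proj_node[where 'k='k], of p A] by auto
  show "count (fat_nodes D S :: ('k ^ 3) set multiset) (proj_node p) = 2" if "p \<in> D"
    using that assms *[of p D] *[of p S] by (auto simp: fat_nodes_def)
  show "count (fat_nodes D S :: ('k ^ 3) set multiset) (proj_node p) = 1" if "p \<in> S"
    using that assms *[of p D] *[of p S] by (auto simp: fat_nodes_def)
qed

lemma set_mset_fat_nodes:
  "finite D \<Longrightarrow> finite S \<Longrightarrow> set_mset (fat_nodes D S) = proj_node ` D \<union> proj_node ` S"
  by (simp add: fat_nodes_def numeral_2_eq_2)

lemma double_reduced_points_fat_nodes:
  assumes "finite D" "finite S" "D \<inter> S = {}" "\<forall>p\<in>D \<union> S. fst p < snd p"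
  shows "double_points (fat_nodes D S :: ('k::field_char_0 ^ 3) set multiset) = proj_node ` D"
    and "reduced_points (fat_nodes D S :: ('k::field_char_0 ^ 3) set multiset) = proj_node ` S"
  by (auto simp: double_points_def reduced_points_def set_mset_fat_nodes[OF assms(1,2)]
      count_fat_nodes[OF assms])

lemma homog_part_fat_ideal:
  assumes "finite D" "finite S" "D \<inter> S = {}" "\<forall>p\<in>D \<union> S. fst p < snd p"
  shows "homog_part t \<inter> fat_ideal (fat_nodes D S) =
    (forms_through D S t :: 'k::field_char_0 poly3 set)"
proof -
  have "f \<in> fat_ideal (fat_nodes D S) \<longleftrightarrow> f \<in> forms_through D S t"
    if f: "f \<in> homog_part t" for f :: "'k poly3"
  proof -
    have ne: "fst p \<noteq> snd p" if "p \<in> D" for p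
      using that assms(4) by (metis UnI1 less_irrefl)
    have "f \<in> fat_ideal (fat_nodes D S) \<longleftrightarrow>
        (\<forall>p\<in>D. f \<in> ideal_power (point_ideal (proj_node p)) 2) \<and>
        (\<forall>p\<in>S. f \<in> ideal_power (point_ideal (proj_node p)) 1)"
      using assms count_fat_nodes[OF assms, where 'k='k]
      by (simp add: fat_ideal_def set_mset_fat_nodes ball_Un)
    also have "\<dots> \<longleftrightarrow> f \<in> forms_through D S t"
      using f ne unfolding ideal_power_1
      by (simp add: forms_through_def homogeneous_in_ideal_power_2_iff[OF f]
          homogeneous_in_point_ideal_iff[OF f])
    finally show ?thesis .
  qed
  then show ?thesis by (auto simp: forms_through_def)
qed

theorem hilbert_function_fat_nodes:
  assumes "full_reduction D S ss ds" "finite D" "finite S" "D \<inter> S = {}"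
    "\<forall>p\<in>D \<union> S. fst p < snd p" "sorted_wrt (>) ds"
  shows "hilbert_function (fat_ideal (fat_nodes D S) :: 'k::field_char_0 poly3 set) t = staircase ds t"
proof -
  obtain bs :: "'k poly3 list" where "set bs \<subseteq> homog_part t" "length bs = staircase ds t"
    "indep_mod (forms_through D S t) bs" "spans_mod (forms_through D S t) (homog_part t) bs"
    using full_reduction_basis[OF assms] by blast
  then show ?thesis
    using hilbert_function_eq_length[OF ideal_subspace[OF ideal_fat_ideal], of bs t "fat_nodes D S"]
    by (simp add: homog_part_fat_ideal assms)
qed

section \<open>Placing the points\<close>

text \<open>
  The double points are the pairs $(i, k)$ with \<open>k \<in> K i\<close>, where always $i < k < \alpha$, and row \<open>i\<close>
  receives \<open>n i\<close> reduced points. When the lines before \<open>m\<close> have been removed, the pairs $(i, k)$ with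
  $m \le i$ are still double, and those with $i < m \le k$ have become reduced.
\<close>

lemma full_reduction_grid:
  fixes K :: "nat \<Rightarrow> nat set" and r :: "nat \<Rightarrow> nat"
  assumes K: "\<And>i. i < \<alpha> \<Longrightarrow> K i \<subseteq> {i<..<\<alpha>}"
    and r: "\<And>i. i < \<alpha> \<Longrightarrow> r i = 2 * card (K i) + card {l. l < i \<and> i \<in> K l} + n i"
  shows "full_reduction (Sigma {..<\<alpha>} K) (Sigma {..<\<alpha>} (\<lambda>i. {\<alpha>..<\<alpha> + n i})) [0..<\<alpha>] (map r [0..<\<alpha>])"
proof -
  have K': "i < k \<and> k < \<alpha>" if "k \<in> K i" "i < \<alpha>" for i k
    using K[OF that(2)] that(1) by auto
  define DD where "DD m = {(i, k). m \<le> i \<and> i < \<alpha> \<and> k \<in> K i}" for m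
  define SS where "SS m = {(i, k). i < m \<and> i < \<alpha> \<and> m \<le> k \<and> k \<in> K i} \<union>
    {(i, k). m \<le> i \<and> i < \<alpha> \<and> \<alpha> \<le> k \<and> k < \<alpha> + n i}" for m
  have "full_reduction (DD m) (SS m) [m..<\<alpha>] (map r [m..<\<alpha>])" if "m \<le> \<alpha>" for m
    using that
  proof (induction m rule: inc_induct)
    case base
    have "DD \<alpha> = {}" by (auto simp: DD_def)
    moreover have "SS \<alpha> = {}" by (auto simp: SS_def dest: K')
    ultimately show ?case by (simp add: full_reduction_Nil)
  next
    case (step m)
    then have m: "m < \<alpha>" by simp
    have 1: "DD m - on_tangent m = DD (Suc m)"
      by (auto simp: DD_def on_tangent_def dest: K')
    have 2: "(SS m - on_tangent m) \<union> (DD m \<inter> on_tangent m) = SS (Suc m)"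
      using m by (auto simp: DD_def SS_def on_tangent_def dest: K')
    have "DD m \<inter> on_tangent m = Pair m ` K m"
      using m by (auto simp: DD_def on_tangent_def dest: K')
    then have 3: "card (DD m \<inter> on_tangent m) = card (K m)"
      by (simp add: card_image inj_on_def)
    have "SS m \<inter> on_tangent m = (\<lambda>l. (l, m)) ` {l. l < m \<and> m \<in> K l} \<union> Pair m ` {\<alpha>..<\<alpha> + n m}"
      using m by (auto simp: SS_def on_tangent_def dest: K')
    moreover have "card ((\<lambda>l. (l, m)) ` {l. l < m \<and> m \<in> K l} \<union> Pair m ` {\<alpha>..<\<alpha> + n m})
        = card {l. l < m \<and> m \<in> K l} + n m"
      by (subst card_Un_disjoint) (auto simp: card_image inj_on_def)
    ultimately have 4: "card (SS m \<inter> on_tangent m) = card {l. l < m \<and> m \<in> K l} + n m" by simp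
    have "full_reduction (DD m) (SS m) (m # [Suc m..<\<alpha>]) (r m # map r [Suc m..<\<alpha>])"
      using step.IH r[OF m] by (intro full_reduction_Cons) (simp_all add: 1 2 3 4)
    then show ?case using m by (simp add: upt_conv_Cons)
  qed
  from this[of 0] have "full_reduction (DD 0) (SS 0) [0..<\<alpha>] (map r [0..<\<alpha>])" by simp
  moreover have "DD 0 = Sigma {..<\<alpha>} K" by (auto simp: DD_def)
  moreover have "SS 0 = Sigma {..<\<alpha>} (\<lambda>i. {\<alpha>..<\<alpha> + n i})" by (auto simp: SS_def)
  ultimately show ?thesis by simp
qed

lemma staircase_sum: "staircase ds t = (\<Sum>i<length ds. min (ds ! i) (Suc t - i))"
proof (induction ds arbitrary: t)
  case (Cons d ds)
  then show ?case
    by (cases t) (simp_all add: sum.lessThan_Suc_shift del: sum.lessThan_Suc)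
qed simp

text \<open>
  Row \<open>i\<close> can lose units to at most \<open>i\<close> earlier rows, so that $r_i - i$ units are always left for its own
  double points. If it has none, the only danger is being chosen by too many earlier rows; row \<open>l\<close> chooses
  row \<open>i\<close> only if $l + 1 \le r_i$, and there are at most $r_i$ such \<open>l\<close>.
\<close>

lemma choose_neighbours:
  fixes r :: "nat \<Rightarrow> nat" and \<alpha> :: nat
  defines "N \<equiv> \<lambda>i. {k. i < k \<and> k < \<alpha> \<and> Suc i \<le> r k}"
  obtains K where "\<And>i. K i \<subseteq> {i<..<\<alpha>}" "\<And>i. card (K i) = min ((r i - i) div 2) (card (N i))"
    "\<And>i. i < \<alpha> \<Longrightarrow> 2 * card (K i) + card {l. l < i \<and> i \<in> K l} \<le> r i"
proof -
  have "\<exists>A. A \<subseteq> N i \<and> card A = min ((r i - i) div 2) (card (N i))" for i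
    by (meson min.cobounded2 obtain_subset_with_card_n)
  then obtain K where K: "\<And>i. K i \<subseteq> N i" "\<And>i. card (K i) = min ((r i - i) div 2) (card (N i))"
    by metis
  have "2 * card (K i) + card {l. l < i \<and> i \<in> K l} \<le> r i" if "i < \<alpha>" for i
  proof (cases "card (K i) = 0")
    case True
    have "{l. l < i \<and> i \<in> K l} \<subseteq> {..<r i}" using K(1) by (fastforce simp: N_def)
    then show ?thesis using True card_mono[of "{..<r i}" "{l. l < i \<and> i \<in> K l}"] by simp
  next
    case False
    have "card {l. l < i \<and> i \<in> K l} \<le> i"
      using card_mono[of "{..<i}" "{l. l < i \<and> i \<in> K l}"] by auto
    moreover have "card (K i) \<le> (r i - i) div 2" using K(2)[of i] by simp
    ultimately show ?thesis using False by linarith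
  qed
  moreover have "K i \<subseteq> {i<..<\<alpha>}" for i using K(1)[of i] by (auto simp: N_def)
  ultimately show thesis using that K(2) by blast
qed

context
  fixes h :: "nat list" and \<alpha> :: nat
  assumes valid: "valid_hilbert_function h \<alpha>"
begin

lemma valid_antimono:
  assumes "\<alpha> \<le> i" "i \<le> j" "j < length h"
  shows "h ! j \<le> h ! i"
  using assms(2,3)
proof (induction j rule: dec_induct)
  case (step j)
  then have "h ! Suc j \<le> h ! j" using valid assms(1) by (simp add: valid_hilbert_function_def)
  with step show ?case by simp
qed simp

lemma valid_le_alpha:
  assumes "j < length h"
  shows "h ! j \<le> \<alpha>"
proof (cases "j < \<alpha>")
  case True
  then show ?thesis using valid by (simp add: valid_hilbert_function_def)
next
  case False
  then have "h ! j \<le> h ! \<alpha>" using assms by (intro valid_antimono) simp_all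
  also have "h ! \<alpha> \<le> \<alpha>" using valid False assms by (simp add: valid_hilbert_function_def)
  finally show ?thesis .
qed

text \<open>
  The entries rise by one up to index $\alpha - 1$ and do not increase afterwards, so that a level
  set has no gaps.
\<close>

lemma level_set_interval:
  assumes i: "i < \<alpha>"
  shows "{j. j < length h \<and> Suc i \<le> h ! j} = {i..<i + conjugate h (Suc i)}"
proof -
  let ?A = "{j. j < length h \<and> Suc i \<le> h ! j}"
  have small: "h ! j = Suc j" if "j < \<alpha>" for j
    using valid that by (simp add: valid_hilbert_function_def)
  have "\<alpha> \<le> length h" using valid by (simp add: valid_hilbert_function_def)
  then have iA: "i \<in> ?A" using i small by simp
  have fin: "finite ?A" by simp
  have "?A = {i..Max ?A}"
  proof (intro equalityI subsetI)
    fix j assume j: "j \<in> ?A"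
    have "i \<le> j"
    proof (rule ccontr)
      assume "\<not> i \<le> j"
      with j small[of j] i show False by simp
    qed
    with j fin show "j \<in> {i..Max ?A}" by (simp only: atLeastAtMost_iff Max_ge)
  next
    fix j assume j: "j \<in> {i..Max ?A}"
    have M: "Max ?A \<in> ?A" using fin iA by (intro Max_in) auto
    with j have len: "j < length h" by auto
    have "Suc i \<le> h ! j"
    proof (cases "j < \<alpha>")
      case True
      with j small show ?thesis by simp
    next
      case False
      then have "h ! Max ?A \<le> h ! j" using j M by (intro valid_antimono) auto
      with M show ?thesis by auto
    qed
    with len show "j \<in> ?A" by simp
  qed
  moreover have "i \<le> Max ?A" using fin iA by (rule Max_ge)
  moreover from calculation have "conjugate h (Suc i) = Suc (Max ?A) - i"
    unfolding conjugate_def by (metis card_atLeastAtMost)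
  ultimately show ?thesis by (simp add: atLeastLessThanSuc_atLeastAtMost)
qed

text \<open>
  The rows start one step later each time and do not end later.
\<close>

lemma conjugate_strict_decreasing:
  assumes "i < j" "j < \<alpha>"
  shows "conjugate h (Suc j) < conjugate h (Suc i)"
proof -
  have "i + conjugate h (Suc i) \<ge> j + conjugate h (Suc j)" if "conjugate h (Suc j) > 0"
  proof -
    have "j + conjugate h (Suc j) - 1 \<in> {j..<j + conjugate h (Suc j)}" using that by auto
    then have "j + conjugate h (Suc j) - 1 \<in> {i..<i + conjugate h (Suc i)}"
      using assms by (auto simp flip: level_set_interval)
    then show ?thesis by auto
  qed
  moreover have "conjugate h (Suc i) > 0"
  proof -
    have "i \<in> {j. j < length h \<and> Suc i \<le> h ! j}"
      using assms valid by (auto simp: valid_hilbert_function_def)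
    with assms show ?thesis by (simp add: level_set_interval)
  qed
  ultimately show ?thesis using assms by linarith
qed

text \<open>
  Both sides count the cells in the columns up to \<open>t\<close> of the diagram of \<open>h\<close>, by rows and by columns.
\<close>

lemma staircase_conjugate:
  "staircase (map (\<lambda>i. conjugate h (Suc i)) [0..<\<alpha>]) t = (\<Sum>j<min (Suc t) (length h). h ! j)"
proof -
  have "staircase (map (\<lambda>i. conjugate h (Suc i)) [0..<\<alpha>]) t =
      (\<Sum>i<\<alpha>. min (conjugate h (Suc i)) (Suc t - i))"
    by (simp add: staircase_sum)
  also have "\<dots> = (\<Sum>i<\<alpha>. card {j \<in> {..<min (Suc t) (length h)}. Suc i \<le> h ! j})"
  proof (intro sum.cong refl)
    fix i assume "i \<in> {..<\<alpha>}"
    then have "{j \<in> {..<min (Suc t) (length h)}. Suc i \<le> h ! j} =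
        {i..<i + conjugate h (Suc i)} \<inter> {..<Suc t}"
      by (auto simp flip: level_set_interval)
    also have "\<dots> = {i..<min (i + conjugate h (Suc i)) (Suc t)}" by auto
    finally show "min (conjugate h (Suc i)) (Suc t - i) =
        card {j \<in> {..<min (Suc t) (length h)}. Suc i \<le> h ! j}" by simp
  qed
  also have "\<dots> = (\<Sum>j<min (Suc t) (length h). h ! j)"
  proof (rule sum_multicount_gen)
    show "\<forall>j\<in>{..<min (Suc t) (length h)}. card {i \<in> {..<\<alpha>}. Suc i \<le> h ! j} = h ! j"
    proof
      fix j assume "j \<in> {..<min (Suc t) (length h)}"
      then have "{i \<in> {..<\<alpha>}. Suc i \<le> h ! j} = {..<h ! j}"
        using valid_le_alpha[of j] by auto
      then show "card {i \<in> {..<\<alpha>}. Suc i \<le> h ! j} = h ! j" by simp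
    qed
  qed auto
  finally show ?thesis .
qed

text \<open>
  Counting rows from zero; the last row has no later rows to choose, so that its summand vanishes.
\<close>

lemma double_count_shift:
  "double_count h \<alpha> = (\<Sum>i<\<alpha>. min ((conjugate h (Suc i) - i) div 2)
     (card {k. i < k \<and> k < \<alpha> \<and> Suc i \<le> conjugate h (Suc k)}))"
proof -
  let ?f = "\<lambda>i. min ((conjugate h (Suc i) - i) div 2)
     (card {k. i < k \<and> k < \<alpha> \<and> Suc i \<le> conjugate h (Suc k)})"
  obtain \<beta> where \<beta>: "\<alpha> = Suc \<beta>"
    using valid by (cases \<alpha>) (simp_all add: valid_hilbert_function_def)
  have "card {k. Suc (Suc i) \<le> k \<and> k \<le> \<alpha> \<and> Suc i \<le> conjugate h k} =
      card {k. i < k \<and> k < \<alpha> \<and> Suc i \<le> conjugate h (Suc k)}" for i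
  proof -
    have "{k. Suc (Suc i) \<le> k \<and> k \<le> \<alpha> \<and> Suc i \<le> conjugate h k} =
        Suc ` {k. i < k \<and> k < \<alpha> \<and> Suc i \<le> conjugate h (Suc k)}"
    proof (intro equalityI subsetI)
      fix k assume "k \<in> {k. Suc (Suc i) \<le> k \<and> k \<le> \<alpha> \<and> Suc i \<le> conjugate h k}"
      then show "k \<in> Suc ` {k. i < k \<and> k < \<alpha> \<and> Suc i \<le> conjugate h (Suc k)}"
        by (cases k) auto
    qed auto
    then show ?thesis by (simp add: card_image)
  qed
  moreover have "{1..\<alpha> - 1} = Suc ` {..<\<beta>}"
    by (simp add: \<beta> lessThan_atLeast0 flip: atLeastLessThanSuc_atLeastAtMost)
  ultimately have "double_count h \<alpha> = (\<Sum>i<\<beta>. ?f i)"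
    by (simp add: double_count_def sum.reindex)
  also have "\<dots> = (\<Sum>i<\<alpha>. ?f i)"
  proof -
    have "{k. \<beta> < k \<and> k < \<alpha> \<and> Suc \<beta> \<le> conjugate h (Suc k)} = {}" by (auto simp: \<beta>)
    then have "?f \<beta> = 0" by (simp only: card.empty min_0R)
    then show ?thesis unfolding \<beta> sum.lessThan_Suc by simp
  qed
  finally show ?thesis .
qed

end

theorem theorem3p9:
  fixes h :: "nat list" and \<alpha> d :: nat
  assumes "valid_hilbert_function h \<alpha>"
    and "d = double_count h \<alpha>"
  shows "\<exists>Z :: ('k::{alg_closed_field, field_char_0} ^ 3) set multiset.
    fat_points Z \<and>
    set_mset Z = double_points Z \<union> reduced_points Z \<and>
    card (double_points Z) = d \<and>
    int (card (reduced_points Z)) = int (sum_list h) - 3 * int d \<and>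
    (\<forall>i. hilbert_diff (fat_ideal Z) i = (if i < length h then int (h ! i) else 0))"
proof -
  note valid = assms(1)
  let ?r = "\<lambda>i. conjugate h (Suc i)"
  obtain K where K: "\<And>i. K i \<subseteq> {i<..<\<alpha>}"
    "\<And>i. card (K i) = min ((?r i - i) div 2) (card {k. i < k \<and> k < \<alpha> \<and> Suc i \<le> ?r k})"
    "\<And>i. i < \<alpha> \<Longrightarrow> 2 * card (K i) + card {l. l < i \<and> i \<in> K l} \<le> ?r i"
    using choose_neighbours[of \<alpha> ?r] by blast
  define n where "n i = ?r i - (2 * card (K i) + card {l. l < i \<and> i \<in> K l})" for i
  define D where "D = Sigma {..<\<alpha>} K"
  define S where "S = Sigma {..<\<alpha>} (\<lambda>i. {\<alpha>..<\<alpha> + n i})"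
  let ?ds = "map ?r [0..<\<alpha>]"
  have red: "full_reduction D S [0..<\<alpha>] ?ds"
    unfolding D_def S_def by (rule full_reduction_grid) (use K in \<open>auto simp: n_def\<close>)
  have finK: "finite (K i)" for i by (rule finite_subset[OF K(1)]) simp
  then have fin: "finite D" "finite S" by (simp_all add: D_def S_def)
  have K': "i < k \<and> k < \<alpha>" if "k \<in> K i" for i k using K(1)[of i] that by auto
  have disj: "D \<inter> S = {}" by (auto simp: D_def S_def dest: K')
  have less: "\<forall>p\<in>D \<union> S. fst p < snd p" by (auto simp: D_def S_def dest: K')
  have dec: "sorted_wrt (>) ?ds"
    by (auto simp: sorted_wrt_iff_nth_less intro: conjugate_strict_decreasing[OF valid])
  let ?Z = "fat_nodes D S :: ('k ^ 3) set multiset"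
  have hf: "hilbert_function (fat_ideal ?Z) t = (\<Sum>j<min (Suc t) (length h). h ! j)" for t
    using hilbert_function_fat_nodes[OF red fin disj less dec, where 'k='k] staircase_conjugate[OF valid]
    by simp
  have cardD: "card D = d"
    unfolding D_def assms(2) double_count_shift[OF valid] by (simp add: card_SigmaI finK K(2))
  have inj: "inj_on (proj_node :: _ \<Rightarrow> ('k ^ 3) set) (D \<union> S)"
    by (rule inj_on_subset[OF inj_on_proj_node]) (use less in auto)
  have "sum_list ?ds = staircase ?ds (length h)"
  proof (rule staircase_saturated[symmetric, OF dec], intro ballI)
    fix x assume "x \<in> set ?ds"
    then obtain i where "x = ?r i" by auto
    moreover have "?r i \<le> card {..<length h}"
      unfolding conjugate_def by (intro card_mono) auto
    ultimately show "x \<le> Suc (length h)" by simp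
  qed
  also have "\<dots> = sum_list h"
    by (simp add: staircase_conjugate[OF valid] sum_list_sum_nth atLeast0LessThan)
  finally have "sum_list h = 3 * d + card S"
    using full_reduction_degree[OF red fin disj] cardD by simp
  moreover have "fat_points ?Z"
    using fin by (auto simp: fat_points_def set_mset_fat_nodes proj_node_in_proj_plane)
  moreover have "card (double_points ?Z) = d" "card (reduced_points ?Z) = card S"
    using inj cardD by (simp_all add: double_reduced_points_fat_nodes[OF fin disj less] card_image inj_on_Un)
  moreover have "hilbert_diff (fat_ideal ?Z) i = (if i < length h then int (h ! i) else 0)" for i
  proof -
    have "2 \<le> length h" using valid by (simp add: valid_hilbert_function_def)
    then show ?thesis by (cases i) (auto simp: hilbert_diff_def hf min_def)
  qed
  ultimately show ?thesis
    by (intro exI[of _ ?Z])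
      (simp add: set_mset_fat_nodes[OF fin] double_reduced_points_fat_nodes[OF fin disj less])
qed

end
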